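(* Every conditionally $\aleph_0$-meet-continuous relatively complemented modular lattice is normal.
   Context: Lattices are not assumed to be bounded. A lattice is relatively complemented if every closed interval $[a,b]$ of it is complemented. A lattice $K$ is $\aleph_0$-meet-continuous if for every $a\in K$ and every increasing sequence $\langle b_n\mid n\in\omega\rangle$ of elements of $K$, the supremum $\bigvee_nb_n$ exists and $a\wedge\bigvee_nb_n=\bigvee_n(a\wedge b_n)$. A lattice is conditionally $\aleph_0$-meet-continuous if each of its closed intervals is $\aleph_0$-meet-continuous. In a modular lattice with zero, $x\perp y$ means $x\wedge y=0$, and $z=x\oplus y$ means $x\wedge y=0$ and $x\vee y=z$. Elements $x,y$ of a lattice are perspective, $x\sim y$, if there is $t$ with $x\wedge t=y\wedge t$ and $x\vee t=y\vee t$. A normal equivalence on a modular lattice $K$ with zero is an equivalence relation $\equiv$ on $K$ such that: (E1) $\equiv$ is additive ($x\equiv x'$, $y\equiv y'$ and both $x\oplus y$ and $x'\oplus y'$ defined imply $x\oplus y\equiv x'\oplus y'$) and refining (if $y\equiv x_0\oplus x_1$, then there are $y_0\equiv x_0$ and $y_1\equiv x_1$ with $y=y_0\oplus y_1$); (E2) $x\sim y$ implies $x\equiv y$; (E3) $x\perp y$ and $x\equiv y$ imply $x\sim y$. A modular lattice with zero is normal if there is at least one normal equivalence on it. A relatively complemented modular lattice (not necessarily with zero) is normal if each of its closed intervals is normal; for relatively complemented modular lattices with zero the two definitions agree. *)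

theory Defs
  imports Main "HOL-Library.Lub_Glb"
begin

text \<open>
  All notions are relative to a carrier \<open>K\<close>, meant to be a sublattice of the ambient
  lattice type: either the whole type or one of its closed intervals. Since such a \<open>K\<close> is closed
  under \<^const>\<open>inf\<close> and \<^const>\<open>sup\<close>, its binary meets and joins are the ambient ones, whereas
  quantifiers, least upper bounds, zero and unit are taken inside \<open>K\<close>.
\<close>

definition modular_lattice :: "'a::lattice set \<Rightarrow> bool" where
  "modular_lattice K \<longleftrightarrow>
     (\<forall>x\<in>K. \<forall>y\<in>K. \<forall>z\<in>K. x \<le> z \<longrightarrow> sup x (inf y z) = inf (sup x y) z)"

definition is_zero :: "'a::lattice set \<Rightarrow> 'a \<Rightarrow> bool" where
  "is_zero K z0 \<longleftrightarrow> z0 \<in> K \<and> (\<forall>x\<in>K. z0 \<le> x)"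

definition is_unit_element :: "'a::lattice set \<Rightarrow> 'a \<Rightarrow> bool" where
  "is_unit_element K e \<longleftrightarrow> e \<in> K \<and> (\<forall>x\<in>K. x \<le> e)"

definition closed_intervals :: "'a::lattice set \<Rightarrow> 'a set set" where
  "closed_intervals K = {K \<inter> {a..b} | a b. a \<in> K \<and> b \<in> K \<and> a \<le> b}"

definition complemented_lattice :: "'a::lattice set \<Rightarrow> bool" where
  "complemented_lattice K \<longleftrightarrow>
     (\<exists>z0 e. is_zero K z0 \<and> is_unit_element K e \<and>
        (\<forall>x\<in>K. \<exists>y\<in>K. inf x y = z0 \<and> sup x y = e))"

definition relatively_complemented :: "'a::lattice set \<Rightarrow> bool" where
  "relatively_complemented K \<longleftrightarrow> (\<forall>I\<in>closed_intervals K. complemented_lattice I)"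

definition aleph0_meet_continuous :: "'a::lattice set \<Rightarrow> bool" where
  "aleph0_meet_continuous K \<longleftrightarrow>
     (\<forall>a\<in>K. \<forall>b::nat \<Rightarrow> 'a. mono b \<and> range b \<subseteq> K \<longrightarrow>
        (\<exists>s. isLub K (range b) s \<and> isLub K (range (\<lambda>n. inf a (b n))) (inf a s)))"

definition conditionally_aleph0_meet_continuous :: "'a::lattice set \<Rightarrow> bool" where
  "conditionally_aleph0_meet_continuous K \<longleftrightarrow>
     (\<forall>I\<in>closed_intervals K. aleph0_meet_continuous I)"

definition perspective :: "'a::lattice set \<Rightarrow> 'a \<Rightarrow> 'a \<Rightarrow> bool" where
  "perspective K x y \<longleftrightarrow> (\<exists>t\<in>K. inf x t = inf y t \<and> sup x t = sup y t)"

text \<open>In the next two definitions \<open>z0\<close> is the zero of the lattice;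
  \<open>is_osum z0 x y z\<close> says that \<open>x \<oplus> y\<close> is defined and equal to \<open>z\<close>.\<close>

definition orthogonal :: "'a::lattice \<Rightarrow> 'a \<Rightarrow> 'a \<Rightarrow> bool" where
  "orthogonal z0 x y \<longleftrightarrow> inf x y = z0"

definition is_osum :: "'a::lattice \<Rightarrow> 'a \<Rightarrow> 'a \<Rightarrow> 'a \<Rightarrow> bool" where
  "is_osum z0 x y z \<longleftrightarrow> orthogonal z0 x y \<and> sup x y = z"

definition additive_rel :: "'a::lattice set \<Rightarrow> 'a \<Rightarrow> ('a \<times> 'a) set \<Rightarrow> bool" where
  "additive_rel K z0 E \<longleftrightarrow>
     (\<forall>x\<in>K. \<forall>x'\<in>K. \<forall>y\<in>K. \<forall>y'\<in>K. \<forall>z\<in>K. \<forall>z'\<in>K.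
        (x, x') \<in> E \<and> (y, y') \<in> E \<and> is_osum z0 x y z \<and> is_osum z0 x' y' z' \<longrightarrow> (z, z') \<in> E)"

definition refining_rel :: "'a::lattice set \<Rightarrow> 'a \<Rightarrow> ('a \<times> 'a) set \<Rightarrow> bool" where
  "refining_rel K z0 E \<longleftrightarrow>
     (\<forall>y\<in>K. \<forall>x0\<in>K. \<forall>x1\<in>K. \<forall>z\<in>K. is_osum z0 x0 x1 z \<and> (y, z) \<in> E \<longrightarrow>
        (\<exists>y0\<in>K. \<exists>y1\<in>K. (y0, x0) \<in> E \<and> (y1, x1) \<in> E \<and> is_osum z0 y0 y1 y))"

definition normal_equivalence :: "'a::lattice set \<Rightarrow> 'a \<Rightarrow> ('a \<times> 'a) set \<Rightarrow> bool" where
  "normal_equivalence K z0 E \<longleftrightarrow>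
     equiv K E \<and>
     additive_rel K z0 E \<and> refining_rel K z0 E \<and>
     (\<forall>x\<in>K. \<forall>y\<in>K. perspective K x y \<longrightarrow> (x, y) \<in> E) \<and>
     (\<forall>x\<in>K. \<forall>y\<in>K. orthogonal z0 x y \<and> (x, y) \<in> E \<longrightarrow> perspective K x y)"

text \<open>Normality of a modular lattice with zero. The zero, being unique, is recovered from \<open>K\<close>.\<close>

definition normal_with_zero :: "'a::lattice set \<Rightarrow> bool" where
  "normal_with_zero K \<longleftrightarrow> (\<exists>z0 E. is_zero K z0 \<and> normal_equivalence K z0 E)"

text \<open>Normality of a relatively complemented modular lattice, possibly without zero.\<close>

definition normal_lattice :: "'a::lattice set \<Rightarrow> bool" where
  "normal_lattice K \<longleftrightarrow> (\<forall>I\<in>closed_intervals K. normal_with_zero I)"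

end

theory Submission imports Defs begin

text \<open>
  Fix a closed interval with least element \<open>0\<close>, and call two of its elements projective by
  decomposition if they are finite orthogonal joins of pieces that are pairwise connected by
  finite chains of perspectivities. This relation is the normal equivalence. Additivity and
  (E2) are built into it. That it is refining, and therefore transitive, is modular lattice theory:
  a perspectivity from \<open>x\<close> to \<open>y\<close> induces an isomorphism of the intervals \<open>[0, x]\<close> and
  \<open>[0, y]\<close>, and two decompositions of one element have a common refinement up to perspectivity
  (\<open>common_refinement\<close>).

  The substance is (E3): orthogonal elements that are projective by decomposition are
  perspective. Axes of perspectivities between orthogonal pairs add up (\<open>persp_sup\<close>), so it is
  enough to treat two orthogonal elements joined by a chain of perspectivities (\<open>persp_of_chain\<close>).
  Cutting an intermediate element of the chain into the part below a given element and a part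
  disjoint from it (\<open>persp_by_cutting\<close>) shortens chains, until only one configuration is left:
  \<open>u \<sim> t \<sim> p \<sim> q\<close>, where \<open>t\<close> and \<open>q\<close> are both disjoint from \<open>u \<squnion> p\<close> but \<open>u\<close> and \<open>p\<close> may
  overlap. There \<open>u \<sim> q\<close> has to be shown (\<open>persp_shift\<close>), and this is where continuity enters.

  The perspectivities through \<open>t\<close> give an isomorphism \<open>f\<close> from \<open>[0, u]\<close> to \<open>[0, p]\<close>, which can
  behave like a shift that moves \<open>u\<close> properly into itself. If \<open>v\<close> and \<open>f v\<close> are disjoint, then
  they form an independent triple with the element of \<open>[0, t]\<close> between them, so that \<open>v \<sim> f v\<close>.
  The part of \<open>u\<close> outside \<open>p\<close> and those of its iterated images under \<open>f\<close> that stay in \<open>u\<close> together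
  generate an element \<open>s\<close>, a countable orthogonal join of pieces that \<open>f\<close> makes disjoint from
  themselves. Each piece is perspective to its image under \<open>f\<close> and hence to a piece of \<open>q\<close>;
  continuity puts these infinitely many perspectivities together. The rest of \<open>u\<close> can be chosen
  inside \<open>p\<close>, so the given perspectivity from \<open>p\<close> to \<open>q\<close> applies to it directly. In this way \<open>u\<close>
  becomes perspective to a part of \<open>q\<close> (\<open>partial_shift\<close>). Using this twice more, with the
  roles of the elements exchanged, makes \<open>q\<close> perspective to a part of \<open>u\<close>, and the Cantor-Bernstein
  argument (\<open>persp_antisym\<close>) completes the proof.
\<close>

unbundle lattice_syntax

section \<open>Independence in a modular lattice above a fixed zero\<close>

locale rc_modular =
  fixes zero :: "'a::lattice" ("\<zero>")
  assumes modular_law: "(x::'a) \<le> z \<Longrightarrow> x \<squnion> (y \<sqinter> z) = (x \<squnion> y) \<sqinter> z"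
    and relative_complement: "(a::'a) \<le> x \<Longrightarrow> x \<le> b \<Longrightarrow> \<exists>y. x \<sqinter> y = a \<and> x \<squnion> y = b"
begin

abbreviation orth :: "'a \<Rightarrow> 'a \<Rightarrow> bool" (infix "\<perp>" 50) where
  "x \<perp> y \<equiv> x \<sqinter> y = \<zero>"

lemma orth_sym: "x \<perp> y \<Longrightarrow> y \<perp> x"
  by (simp add: inf_commute)

lemma orth_ge: assumes "x \<perp> y" shows "\<zero> \<le> x" "\<zero> \<le> y"
  using assms inf_le1 inf_le2 by metis+

lemma orth_mono: "x \<perp> y \<Longrightarrow> a \<le> x \<Longrightarrow> b \<le> y \<Longrightarrow> \<zero> \<le> a \<Longrightarrow> \<zero> \<le> b \<Longrightarrow> a \<perp> b"
  by (metis inf_greatest inf_mono order_antisym)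

lemma inf_eq_within: "(x::'a) \<le> z \<Longrightarrow> t \<sqinter> z = s \<Longrightarrow> x \<sqinter> t = x \<sqinter> s"
  by (metis inf.assoc inf.commute inf_absorb1)

lemma complement:
  assumes "\<zero> \<le> x" "x \<le> y"
  obtains c where "x \<perp> c" "x \<squnion> c = y" "\<zero> \<le> c" "c \<le> y"
  using relative_complement[OF assms] by (metis inf_le2 sup_ge2)

text \<open>Together with symmetry, this turns the two conditions that express independence of a triple
  into the same conditions for any of its permutations.\<close>

lemma orth_assoc:
  assumes "x \<perp> y" "(x \<squnion> y) \<perp> z"
  shows "x \<perp> (y \<squnion> z)"
proof -
  have "x \<sqinter> (y \<squnion> z) \<le> (y \<squnion> z) \<sqinter> (x \<squnion> y)"
    by (simp add: le_infI1)
  also have "\<dots> = y \<squnion> (z \<sqinter> (x \<squnion> y))"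
    by (simp add: modular_law)
  also have "\<dots> = y"
    using assms orth_ge(2)[OF assms(1)] by (simp add: inf_commute sup_absorb1)
  finally have "x \<sqinter> (y \<squnion> z) \<le> x \<sqinter> y" by simp
  moreover have "x \<sqinter> y \<le> x \<sqinter> (y \<squnion> z)"
    by (simp add: le_infI2)
  ultimately show ?thesis using assms(1) by (simp add: order_antisym)
qed

text \<open>Below two independent elements, meets of joins are computed componentwise: modulo \<open>Q\<close>,
  only the meet of \<open>a\<close> and \<open>b\<close> remains, which is zero, and the same holds modulo \<open>P\<close>.\<close>

lemma orth_sup_sup:
  assumes PQ: "P \<perp> Q" and "a \<le> P" "b \<le> P" "c \<le> Q" "d \<le> Q"
    and ab: "a \<perp> b" and cd: "c \<perp> d"
  shows "(a \<squnion> c) \<perp> (b \<squnion> d)"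
proof -
  let ?r = "(a \<squnion> c) \<sqinter> (b \<squnion> d)"
  note ge = orth_ge[OF PQ] orth_ge[OF ab] orth_ge[OF cd]
  have half: "(a' \<squnion> c') \<sqinter> (b' \<squnion> d') \<le> Q'"
    if "P' \<perp> Q'" "a' \<le> P'" "b' \<le> P'" "c' \<le> Q'" "d' \<le> Q'" "a' \<perp> b'" for P' Q' a' b' c' d'
  proof -
    have "(a' \<squnion> Q') \<sqinter> b' \<le> (a' \<squnion> Q') \<sqinter> P' \<sqinter> b'"
      using that(3) by (simp add: le_infI1 le_infI2)
    also have "(a' \<squnion> Q') \<sqinter> P' = a'"
      using that(1,2) orth_ge(1)[OF that(6)]
      by (metis inf_commute modular_law sup_absorb1)
    finally have *: "(a' \<squnion> Q') \<sqinter> b' \<le> \<zero>" using that(6) by simp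
    have "a' \<squnion> c' \<le> a' \<squnion> Q'" "b' \<squnion> d' \<le> b' \<squnion> Q'"
      using that(4,5) by (auto intro: le_supI2)
    then have "(a' \<squnion> c') \<sqinter> (b' \<squnion> d') \<le> (b' \<squnion> Q') \<sqinter> (a' \<squnion> Q')"
      by (simp add: le_infI1 le_infI2)
    also have "\<dots> = Q' \<squnion> (b' \<sqinter> (a' \<squnion> Q'))"
      by (simp add: modular_law sup_commute)
    also have "\<dots> \<le> Q'"
      using * orth_ge(2)[OF that(1)] by (simp add: inf_commute)
    finally show ?thesis .
  qed
  have "?r \<le> Q" by (rule half[OF PQ assms(2-5) ab])
  moreover have "?r \<le> P"
    using half[OF orth_sym[OF PQ] assms(4,5,2,3) cd] by (simp add: sup_commute)
  ultimately have "?r \<le> \<zero>" using PQ by (metis le_inf_iff)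
  moreover have "\<zero> \<le> ?r" using ge by (simp add: le_supI1)
  ultimately show ?thesis by simp
qed

section \<open>Perspectivity\<close>

definition perspective_by :: "'a \<Rightarrow> 'a \<Rightarrow> 'a \<Rightarrow> bool" where
  "perspective_by t x y \<longleftrightarrow> x \<perp> t \<and> y \<perp> t \<and> x \<squnion> t = y \<squnion> t"

definition persp :: "'a \<Rightarrow> 'a \<Rightarrow> bool" (infix "\<sim>" 50) where
  "x \<sim> y \<longleftrightarrow> (\<exists>t. perspective_by t x y)"

lemma persp_ge: assumes "x \<sim> y" shows "\<zero> \<le> x" "\<zero> \<le> y"
  using assms orth_ge unfolding persp_def perspective_by_def by blast+

lemma persp_sym: "x \<sim> y \<Longrightarrow> y \<sim> x"
  unfolding persp_def perspective_by_def by metis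

lemma persp_refl: "\<zero> \<le> x \<Longrightarrow> x \<sim> x"
  unfolding persp_def perspective_by_def by (metis inf_absorb2)

lemma persp_small_axis:
  assumes "x \<sim> y"
  obtains t where "perspective_by t x y" "t \<le> x \<squnion> y"
proof -
  obtain t where t: "x \<perp> t" "y \<perp> t" "x \<squnion> t = y \<squnion> t"
    using assms unfolding persp_def perspective_by_def by blast
  let ?t = "t \<sqinter> (x \<squnion> y)"
  have "x \<sqinter> ?t = \<zero>" "y \<sqinter> ?t = \<zero>"
    using inf_eq_within[of x "x \<squnion> y" t] inf_eq_within[of y "x \<squnion> y" t] t(1,2) by simp_all
  moreover have "x \<squnion> ?t = (x \<squnion> t) \<sqinter> (x \<squnion> y)" "y \<squnion> ?t = (y \<squnion> t) \<sqinter> (x \<squnion> y)"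
    by (simp_all add: modular_law)
  ultimately have "perspective_by ?t x y" using t(3) by (simp add: perspective_by_def)
  then show thesis using that by auto
qed

text \<open>The complement of the common meet inside the axis is an axis that meets both elements in
  zero, so the more liberal notion of perspectivity in a lattice with zero is no weaker.\<close>

lemma persp_of_common_axis:
  assumes "\<zero> \<le> x" "\<zero> \<le> y" "\<zero> \<le> t" "x \<sqinter> t = y \<sqinter> t" "x \<squnion> t = y \<squnion> t"
  shows "x \<sim> y"
proof -
  obtain t' where t': "(x \<sqinter> t) \<perp> t'" "(x \<sqinter> t) \<squnion> t' = t" "\<zero> \<le> t'" "t' \<le> t"
    using complement[of "x \<sqinter> t" t] assms by auto
  have "x \<sqinter> t' = \<zero>" using t'(1,4) by (simp add: inf.assoc inf_absorb2)
  moreover have "y \<sqinter> t' = \<zero>" using t'(1,4) assms(4) by (simp add: inf.assoc inf_absorb2)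
  moreover have "x \<squnion> t' = x \<squnion> t" using t'(2) by (metis sup_inf_absorb sup_assoc)
  moreover have "y \<squnion> t' = y \<squnion> t" using t'(2) assms(4) by (metis sup_inf_absorb sup_assoc)
  ultimately show ?thesis using assms(5) unfolding persp_def perspective_by_def by metis
qed

lemma common_complement_persp:
  assumes "c \<perp> x" "c \<perp> y" "c \<squnion> x = c \<squnion> y"
  shows "x \<sim> y"
  using assms unfolding persp_def perspective_by_def
  by (metis inf_commute sup_commute)

text \<open>The pairs \<open>x1, y1\<close> and \<open>x2, y2\<close> span independent elements, so the componentwise
  computation of meets applies to the join of the two axes. The axis is made explicit because
  infinite joins of perspectivities need axes that extend each other.\<close>

lemma perspective_by_sup:
  assumes 1: "perspective_by t1 x1 y1" "t1 \<le> x1 \<squnion> y1"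
    and 2: "perspective_by t2 x2 y2" "t2 \<le> x2 \<squnion> y2"
    and "x1 \<perp> x2" "y1 \<perp> y2" "(x1 \<squnion> x2) \<perp> (y1 \<squnion> y2)"
  shows "perspective_by (t1 \<squnion> t2) (x1 \<squnion> x2) (y1 \<squnion> y2)"
proof -
  have o: "(x1 \<squnion> y1) \<perp> (x2 \<squnion> y2)"
    by (rule orth_sup_sup[OF assms(7)]) (use assms in auto)
  have "(x1 \<squnion> x2) \<perp> (t1 \<squnion> t2)" "(y1 \<squnion> y2) \<perp> (t1 \<squnion> t2)"
    by (rule orth_sup_sup[OF o]; use 1 2 in \<open>simp add: perspective_by_def\<close>)+
  moreover have "x1 \<squnion> x2 \<squnion> (t1 \<squnion> t2) = y1 \<squnion> y2 \<squnion> (t1 \<squnion> t2)"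
    using 1 2 unfolding perspective_by_def by (metis sup.assoc sup.left_commute)
  ultimately show ?thesis by (simp add: perspective_by_def)
qed

lemma persp_sup:
  assumes "x1 \<sim> y1" "x2 \<sim> y2" "x1 \<perp> x2" "y1 \<perp> y2" "(x1 \<squnion> x2) \<perp> (y1 \<squnion> y2)"
  shows "x1 \<squnion> x2 \<sim> y1 \<squnion> y2"
  using assms persp_small_axis perspective_by_sup unfolding persp_def by metis

text \<open>Von Neumann's transitivity for an independent triple: as in projective geometry, the axis is
  where the join of the two given axes meets the join of the outer elements.\<close>

lemma persp_trans_independent:
  assumes "x \<sim> y" "y \<sim> z" "x \<perp> y" "(x \<squnion> y) \<perp> z"
  shows "x \<sim> z"
proof -
  obtain s where s: "x \<perp> s" "y \<perp> s" "x \<squnion> s = y \<squnion> s" "s \<le> x \<squnion> y"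
    using persp_small_axis[OF assms(1)] unfolding perspective_by_def by metis
  obtain t where t: "y \<perp> t" "z \<perp> t" "y \<squnion> t = z \<squnion> t" "t \<le> y \<squnion> z"
    using persp_small_axis[OF assms(2)] unfolding perspective_by_def by metis
  let ?r = "(s \<squnion> t) \<sqinter> (x \<squnion> z)"
  note ge = persp_ge[OF assms(1)] persp_ge[OF assms(2)] orth_ge[OF s(1)] orth_ge[OF t(1)]
  have yz: "(x \<squnion> y) \<sqinter> (y \<squnion> z) = y"
  proof -
    have "(x \<squnion> y) \<sqinter> (y \<squnion> z) = y \<squnion> (z \<sqinter> (x \<squnion> y))" by (simp add: modular_law inf_commute)
    then show ?thesis using assms(4) ge by (simp add: inf_commute sup_absorb1)
  qed
  have xy_t: "(x \<squnion> y) \<sqinter> t = \<zero>"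
    using inf_eq_within[OF t(4) yz] t(1) by (simp add: inf_commute)
  have yz_s: "(y \<squnion> z) \<sqinter> s = \<zero>"
    using inf_eq_within[OF s(4), of "y \<squnion> z"] yz s(2) by (simp add: inf_commute)
  have "(s \<squnion> t) \<sqinter> (x \<squnion> y) = s \<squnion> (t \<sqinter> (x \<squnion> y))" using s(4) by (simp add: modular_law)
  also have "\<dots> = s" using xy_t ge by (simp add: inf_commute sup_absorb1)
  finally have "x \<sqinter> (s \<squnion> t) = \<zero>" using inf_eq_within[of x "x \<squnion> y" "s \<squnion> t" s] s(1) by simp
  then have 1: "x \<sqinter> ?r = \<zero>" using inf_eq_within[of x "x \<squnion> z" "s \<squnion> t"] by simp
  have "(t \<squnion> s) \<sqinter> (y \<squnion> z) = t \<squnion> (s \<sqinter> (y \<squnion> z))" using t(4) by (simp add: modular_law)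
  also have "\<dots> = t" using yz_s ge by (simp add: inf_commute sup_absorb1)
  finally have "z \<sqinter> (s \<squnion> t) = \<zero>" using inf_eq_within[of z "y \<squnion> z" "t \<squnion> s" t] t(2) by (simp add: sup_commute)
  then have 2: "z \<sqinter> ?r = \<zero>" using inf_eq_within[of z "x \<squnion> z" "s \<squnion> t"] by simp
  have "x \<squnion> ?r = (x \<squnion> (s \<squnion> t)) \<sqinter> (x \<squnion> z)" "z \<squnion> ?r = (z \<squnion> (s \<squnion> t)) \<sqinter> (x \<squnion> z)"
    by (simp_all add: modular_law)
  moreover have "x \<squnion> (s \<squnion> t) = z \<squnion> (s \<squnion> t)"
    using s(3) t(3) by (metis sup.assoc sup.left_commute)
  ultimately have "x \<squnion> ?r = z \<squnion> ?r" by simp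
  with 1 2 show ?thesis unfolding persp_def perspective_by_def by blast
qed

text \<open>Projection along the axis \<open>t\<close>, which is an isomorphism from \<open>[0, x]\<close> onto \<open>[0, y]\<close> when
  \<open>t\<close> makes \<open>x\<close> and \<open>y\<close> perspective.\<close>

definition persp_map :: "'a \<Rightarrow> 'a \<Rightarrow> 'a \<Rightarrow> 'a" where
  "persp_map t y v = (v \<squnion> t) \<sqinter> y"

lemma persp_map:
  assumes "perspective_by t x y" "\<zero> \<le> v" "v \<le> x"
  shows "perspective_by t v (persp_map t y v)" "persp_map t y v \<le> y" 
    "\<zero> \<le> persp_map t y v" "persp_map t x (persp_map t y v) = v"
proof -
  have t: "x \<perp> t" "y \<perp> t" "x \<squnion> t = y \<squnion> t" using assms(1) by (auto simp: perspective_by_def)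
  note ge = orth_ge[OF t(1)] orth_ge[OF t(2)]
  let ?w = "(v \<squnion> t) \<sqinter> y"
  show w1: "persp_map t y v \<le> y" by (simp add: persp_map_def)
  show w0: "\<zero> \<le> persp_map t y v" using ge assms(2) by (simp add: persp_map_def le_supI1)
  have a: "v \<perp> t" using orth_mono[OF t(1), of v t] assms(2,3) ge by simp
  have b: "?w \<perp> t" using orth_mono[OF t(2), of ?w t] w0 w1 ge by (simp add: persp_map_def)
  have "?w \<squnion> t = t \<squnion> (y \<sqinter> (v \<squnion> t))" by (simp add: inf_commute sup_commute)
  also have "\<dots> = (t \<squnion> y) \<sqinter> (v \<squnion> t)" by (simp add: modular_law)
  also have "\<dots> = v \<squnion> t" using t(3) assms(3) by (metis inf_absorb2 sup.mono order_refl sup_commute)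
  finally have c: "?w \<squnion> t = v \<squnion> t" .
  show "perspective_by t v (persp_map t y v)"
    using a b c by (simp add: perspective_by_def persp_map_def)
  have "(v \<squnion> t) \<sqinter> x = v \<squnion> (t \<sqinter> x)" using assms(3) by (simp add: modular_law)
  then show "persp_map t x (persp_map t y v) = v"
    using c t(1) assms(2) by (simp add: persp_map_def inf_commute sup_absorb1)
qed

lemma persp_map_mono: "v \<le> w \<Longrightarrow> persp_map t y v \<le> persp_map t y w"
  unfolding persp_map_def by (meson inf_mono order_refl sup.mono)

lemma perspective_by_sym: "perspective_by t x y \<Longrightarrow> perspective_by t y x"
  by (simp add: perspective_by_def)

end

context rc_modular begin

section \<open>Isomorphisms of intervals\<close>

text \<open>The inverse \<open>g\<close> is carried along, so that every statement about \<open>f\<close> can also be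
  applied backwards through \<open>iso_sym\<close>.\<close>

definition interval_iso :: "('a \<Rightarrow> 'a) \<Rightarrow> ('a \<Rightarrow> 'a) \<Rightarrow> 'a \<Rightarrow> 'a \<Rightarrow> bool" where
  "interval_iso f g x y \<longleftrightarrow> \<zero> \<le> x \<and> \<zero> \<le> y \<and>
     (\<forall>v. \<zero> \<le> v \<and> v \<le> x \<longrightarrow> \<zero> \<le> f v \<and> f v \<le> y \<and> g (f v) = v) \<and>
     (\<forall>w. \<zero> \<le> w \<and> w \<le> y \<longrightarrow> \<zero> \<le> g w \<and> g w \<le> x \<and> f (g w) = w) \<and>
     (\<forall>v v'. \<zero> \<le> v \<and> v \<le> v' \<and> v' \<le> x \<longrightarrow> f v \<le> f v') \<and>
     (\<forall>w w'. \<zero> \<le> w \<and> w \<le> w' \<and> w' \<le> y \<longrightarrow> g w \<le> g w')"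

lemma iso_sym: "interval_iso f g x y \<Longrightarrow> interval_iso g f y x"
  by (simp add: interval_iso_def)

lemma iso_ends: "interval_iso f g x y \<Longrightarrow> \<zero> \<le> x" "interval_iso f g x y \<Longrightarrow> \<zero> \<le> y"
  by (simp_all add: interval_iso_def)

lemma iso_ge: "interval_iso f g x y \<Longrightarrow> \<zero> \<le> v \<Longrightarrow> v \<le> x \<Longrightarrow> \<zero> \<le> f v"
  and iso_le: "interval_iso f g x y \<Longrightarrow> \<zero> \<le> v \<Longrightarrow> v \<le> x \<Longrightarrow> f v \<le> y"
  and iso_inverse: "interval_iso f g x y \<Longrightarrow> \<zero> \<le> v \<Longrightarrow> v \<le> x \<Longrightarrow> g (f v) = v"
  and iso_mono: "interval_iso f g x y \<Longrightarrow> \<zero> \<le> v \<Longrightarrow> v \<le> v' \<Longrightarrow> v' \<le> x \<Longrightarrow> f v \<le> f v'"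
  by (simp_all add: interval_iso_def)

lemma iso_zero: assumes "interval_iso f g x y" shows "f \<zero> = \<zero>"
proof -
  note i = assms iso_sym[OF assms] and e = iso_ends[OF assms]
  have "f \<zero> \<le> f (g \<zero>)" using iso_mono[OF i(1)] iso_ge[OF i(2)] iso_le[OF i(2)] e by simp
  then have "f \<zero> \<le> \<zero>" using iso_inverse[OF i(2)] e by simp
  moreover have "\<zero> \<le> f \<zero>" using iso_ge[OF i(1)] e by simp
  ultimately show ?thesis by simp
qed

lemma iso_top: assumes "interval_iso f g x y" shows "f x = y"
proof -
  note i = assms iso_sym[OF assms] and e = iso_ends[OF assms]
  have "f (g y) \<le> f x" using iso_mono[OF i(1)] iso_ge[OF i(2)] iso_le[OF i(2)] e by simp
  then have "y \<le> f x" using iso_inverse[OF i(2)] e by simp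
  moreover have "f x \<le> y" using iso_le[OF i(1)] e by simp
  ultimately show ?thesis by simp
qed

lemma iso_inf:
  assumes "interval_iso f g x y" "\<zero> \<le> v" "v \<le> x" "\<zero> \<le> w" "w \<le> x"
  shows "f (v \<sqinter> w) = f v \<sqinter> f w"
proof (rule antisym)
  note i = assms(1) iso_sym[OF assms(1)]
  show "f (v \<sqinter> w) \<le> f v \<sqinter> f w"
    using iso_mono[OF i(1)] assms(2-) by (simp add: le_infI1)
  let ?u = "f v \<sqinter> f w"
  have u: "\<zero> \<le> ?u" "?u \<le> y" using iso_ge[OF i(1)] iso_le[OF i(1)] assms(2-) by (simp_all add: le_infI1)
  have "g ?u \<le> g (f v)" "g ?u \<le> g (f w)"
    using iso_mono[OF i(2)] u iso_le[OF i(1)] assms(2-) by simp_all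
  then have "g ?u \<le> v \<sqinter> w" using iso_inverse[OF i(1)] assms(2-) by simp
  then have "f (g ?u) \<le> f (v \<sqinter> w)"
    using iso_mono[OF i(1)] iso_ge[OF i(2) u] assms(3) by (simp add: le_infI1)
  then show "?u \<le> f (v \<sqinter> w)" using iso_inverse[OF i(2) u] by simp
qed

lemma iso_sup:
  assumes "interval_iso f g x y" "\<zero> \<le> v" "v \<le> x" "\<zero> \<le> w" "w \<le> x"
  shows "f (v \<squnion> w) = f v \<squnion> f w"
proof (rule antisym)
  note i = assms(1) iso_sym[OF assms(1)]
  show "f v \<squnion> f w \<le> f (v \<squnion> w)"
    using iso_mono[OF i(1)] assms(2-) by (simp add: le_supI1)
  let ?u = "f v \<squnion> f w"
  have u: "\<zero> \<le> ?u" "?u \<le> y" using iso_ge[OF i(1)] iso_le[OF i(1)] assms(2-) by (simp_all add: le_supI1)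
  have "g (f v) \<le> g ?u" "g (f w) \<le> g ?u"
    using iso_mono[OF i(2)] u iso_ge[OF i(1)] assms(2-) by simp_all
  then have "v \<squnion> w \<le> g ?u" using iso_inverse[OF i(1)] assms(2-) by simp
  then have "f (v \<squnion> w) \<le> f (g ?u)"
    using iso_mono[OF i(1)] iso_le[OF i(2) u] assms(2) by (simp add: le_supI1)
  then show "f (v \<squnion> w) \<le> ?u" using iso_inverse[OF i(2) u] by simp
qed

lemma iso_orth:
  assumes "interval_iso f g x y" "v \<perp> w" "v \<le> x" "w \<le> x"
  shows "f v \<perp> f w"
  using iso_inf[OF assms(1) orth_ge(1)[OF assms(2)] assms(3) orth_ge(2)[OF assms(2)] assms(4)]
    assms(2) iso_zero[OF assms(1)] by simp

lemma iso_restrict: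
  assumes "interval_iso f g x y" "\<zero> \<le> v" "v \<le> x"
  shows "interval_iso f g v (f v)"
proof -
  note i = assms(1) iso_sym[OF assms(1)]
  have fv: "\<zero> \<le> f v" "f v \<le> y" using iso_ge[OF assms] iso_le[OF assms] .
  have "g w \<le> v" if "\<zero> \<le> w" "w \<le> f v" for w
    using iso_mono[OF i(2) that fv(2)] iso_inverse[OF assms] by simp
  then show ?thesis
    using assms(1,2) fv order_trans[OF _ assms(3)] order_trans[OF _ fv(2)] iso_mono[OF i(1) _ _ assms(3)]
    unfolding interval_iso_def by simp
qed

lemma iso_comp:
  assumes "interval_iso f g x y" "interval_iso f' g' y z"
  shows "interval_iso (\<lambda>v. f' (f v)) (\<lambda>w. g (g' w)) x z"
proof -
  note i = assms and j = assms[THEN iso_sym]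
  have fwd: "f' (f v) \<le> f' (f v')" if "\<zero> \<le> v" "v \<le> v'" "v' \<le> x" for v v'
    using iso_mono[OF i(2) iso_ge[OF i(1) that(1) order_trans[OF that(2,3)]] iso_mono[OF i(1) that]
        iso_le[OF i(1) order_trans[OF that(1,2)] that(3)]] .
  have bwd: "g (g' w) \<le> g (g' w')" if "\<zero> \<le> w" "w \<le> w'" "w' \<le> z" for w w'
    using iso_mono[OF j(1) iso_ge[OF j(2) that(1) order_trans[OF that(2,3)]] iso_mono[OF j(2) that]
        iso_le[OF j(2) order_trans[OF that(1,2)] that(3)]] .
  have "\<forall>v v'. \<zero> \<le> v \<and> v \<le> v' \<and> v' \<le> x \<longrightarrow> f' (f v) \<le> f' (f v')"
    "\<forall>w w'. \<zero> \<le> w \<and> w \<le> w' \<and> w' \<le> z \<longrightarrow> g (g' w) \<le> g (g' w')"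
    using fwd bwd by blast+
  then show ?thesis using assms unfolding interval_iso_def by simp
qed

lemma persp_iso:
  assumes "x \<sim> y"
  obtains f g where "interval_iso f g x y" "\<And>v. \<zero> \<le> v \<Longrightarrow> v \<le> x \<Longrightarrow> v \<sim> f v"
proof -
  obtain t where t: "perspective_by t x y" using assms unfolding persp_def by blast
  note t' = perspective_by_sym[OF t]
  have "interval_iso (persp_map t y) (persp_map t x) x y"
    unfolding interval_iso_def
    using persp_map[OF t] persp_map[OF t'] persp_map_mono persp_ge[OF assms] by auto
  moreover have "v \<sim> persp_map t y v" if "\<zero> \<le> v" "v \<le> x" for v
    using persp_map(1)[OF t that] unfolding persp_def by blast
  ultimately show thesis using that by blast
qed

lemma persp_split:
  assumes "x1 \<squnion> x2 \<sim> y" "x1 \<perp> x2"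
  obtains y1 y2 where "y1 \<perp> y2" "y1 \<squnion> y2 = y" "x1 \<sim> y1" "x2 \<sim> y2"
proof -
  obtain f g where f: "interval_iso f g (x1 \<squnion> x2) y" "\<And>v. \<zero> \<le> v \<Longrightarrow> v \<le> x1 \<squnion> x2 \<Longrightarrow> v \<sim> f v"
    using persp_iso[OF assms(1)] by blast
  note ge = orth_ge[OF assms(2)]
  have "f x1 \<perp> f x2" using iso_orth[OF f(1) assms(2)] by simp
  moreover have "f x1 \<squnion> f x2 = y"
    using iso_sup[OF f(1) ge(1) _ ge(2)] iso_top[OF f(1)] by simp
  ultimately show thesis using that f(2) ge by simp
qed

text \<open>Here \<open>y\<close> may overlap \<open>x\<close>: split off their meet, which is perspective to a part of \<open>z\<close>
  outright; what remains of \<open>x\<close>, \<open>y\<close>, \<open>z\<close> is an independent triple.\<close>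

lemma persp_trans_orth:
  assumes "x \<sim> y" "y \<sim> z" "(x \<squnion> y) \<perp> z"
  shows "x \<sim> z"
proof -
  obtain t where t: "x \<perp> t" "y \<perp> t" "x \<squnion> t = y \<squnion> t"
    using assms(1) unfolding persp_def perspective_by_def by blast
  let ?m = "x \<sqinter> y"
  note ge = persp_ge[OF assms(1)] persp_ge[OF assms(2)]
  obtain x' where x': "?m \<perp> x'" "?m \<squnion> x' = x" using complement[of ?m x] ge by auto
  obtain y' where y': "?m \<perp> y'" "?m \<squnion> y' = y" using complement[of ?m y] ge by auto
  note ge' = orth_ge[OF x'(1)] orth_ge[OF y'(1)]
  have le: "x' \<le> x" "y' \<le> y" "?m \<le> x" "?m \<le> y" using x' y' by (metis sup_ge2)+ (auto)
  have 1: "x' \<perp> (?m \<squnion> t)"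
    using orth_assoc[of x' ?m t] x' t(1) by (simp add: inf_commute sup_commute)
  have 2: "y' \<perp> (?m \<squnion> t)"
    using orth_assoc[of y' ?m t] y' t(2) by (simp add: inf_commute sup_commute)
  have "x' \<squnion> (?m \<squnion> t) = y' \<squnion> (?m \<squnion> t)"
    using x'(2) y'(2) t(3) by (metis sup.assoc sup.commute)
  with 1 2 have xy': "x' \<sim> y'" unfolding persp_def perspective_by_def by blast
  have "x' \<sqinter> y' \<le> x' \<sqinter> ?m" using le by (meson inf_greatest inf_le1 inf_le2 order_trans)
  also have "\<dots> = \<zero>" using x'(1) by (simp add: inf_commute)
  finally have o: "x' \<perp> y'" using ge' by (intro antisym) auto
  obtain z1 z' where z: "z1 \<perp> z'" "z1 \<squnion> z' = z" "?m \<sim> z1" "y' \<sim> z'"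
    using persp_split[OF _ y'(1)] y'(2) assms(2) by metis
  note gez = orth_ge[OF z(1)]
  have "(x' \<squnion> y') \<perp> z'"
    by (rule orth_mono[OF assms(3)]) (use le z ge' gez in \<open>auto intro: le_supI1 le_supI2\<close>)
  then have "x' \<sim> z'" using persp_trans_independent[OF xy' z(4) o] by blast
  moreover have "(?m \<squnion> x') \<perp> (z1 \<squnion> z')"
    by (rule orth_mono[OF assms(3)]) (use x'(2) z(2) ge in auto)
  ultimately have "?m \<squnion> x' \<sim> z1 \<squnion> z'" using persp_sup z x' by blast
  then show ?thesis using x' z by simp
qed

end

section \<open>Limits of increasing sequences\<close>

text \<open>The supremum of a sequence is characterised by its upper set, which makes no reference to a
  carrier.\<close>

definition limit_of :: "(nat \<Rightarrow> 'a::order) \<Rightarrow> 'a \<Rightarrow> bool" where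
  "limit_of b s \<longleftrightarrow> (\<forall>w. s \<le> w \<longleftrightarrow> (\<forall>n. b n \<le> w))"

lemma limit_of_upper: "limit_of b s \<Longrightarrow> b n \<le> s"
  unfolding limit_of_def by blast

lemma limit_of_least: "limit_of b s \<Longrightarrow> (\<And>n. b n \<le> w) \<Longrightarrow> s \<le> w"
  unfolding limit_of_def by blast

lemma (in rc_modular) iso_limit:
  assumes "interval_iso f g x y" "limit_of b s" "s \<le> x" "\<And>n. \<zero> \<le> b n"
  shows "limit_of (\<lambda>n. f (b n)) (f s)"
proof -
  note i = assms(1) iso_sym[OF assms(1)]
  have bs: "b n \<le> s" for n using limit_of_upper[OF assms(2)] .
  have s0: "\<zero> \<le> s" using assms(4) bs order_trans by blast
  have "f s \<le> w" if w: "\<And>n. f (b n) \<le> w" for w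
  proof -
    let ?w = "w \<sqinter> y"
    have *: "f (b n) \<le> ?w" for n
      using w iso_le[OF i(1) assms(4)] bs assms(3) by (meson le_inf_iff order_trans)
    have w0: "\<zero> \<le> ?w"
      using * iso_ge[OF i(1) assms(4)] bs assms(3) by (meson order_trans)
    have "b n \<le> g ?w" for n
    proof -
      have "b n \<le> x" using bs assms(3) order_trans by blast
      then show ?thesis
      using iso_mono[OF i(2) _ *[of n]] iso_ge[OF i(1) assms(4)[of n]] iso_inverse[OF i(1) assms(4)[of n]] by simp
    qed
    then have "s \<le> g ?w" by (rule limit_of_least[OF assms(2)])
    then have "f s \<le> f (g ?w)" using iso_mono[OF i(1) s0] iso_le[OF i(2) w0] by simp
    then show ?thesis using iso_inverse[OF i(2) w0] by simp
  qed
  moreover have "f (b n) \<le> f s" for n using iso_mono[OF i(1) assms(4) bs assms(3)] .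
  ultimately show ?thesis unfolding limit_of_def by (meson order_trans)
qed

locale continuous_modular = rc_modular +
  assumes limit_exists: "mono (b :: nat \<Rightarrow> 'a) \<Longrightarrow> (\<And>n. b n \<le> c) \<Longrightarrow> \<exists>s. limit_of b s"
    and inf_limit: "mono (b :: nat \<Rightarrow> 'a) \<Longrightarrow> limit_of b s \<Longrightarrow> limit_of (\<lambda>n. a \<sqinter> b n) (a \<sqinter> s)"
begin

text \<open>Continuity is used twice, once in each argument.\<close>

lemma orth_limits:
  assumes "mono b" "mono b'" "limit_of b s" "limit_of b' s'" "\<And>n. b n \<perp> b' n"
  shows "s \<perp> s'"
proof -
  have *: "s \<sqinter> b' n \<le> \<zero>" for n
  proof -
    have "b' n \<sqinter> b k \<le> \<zero>" for k
    proof -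
      have "b' n \<sqinter> b k \<le> b (max n k) \<sqinter> b' (max n k)"
        using assms(1,2) by (simp add: monoD le_infI1 le_infI2)
      then show ?thesis using assms(5) by simp
    qed
    then show ?thesis using limit_of_least[OF inf_limit[OF assms(1,3), of "b' n"]]
      by (simp add: inf_commute)
  qed
  have "s \<sqinter> s' \<le> \<zero>"
    by (rule limit_of_least[OF inf_limit[OF assms(2,4), of s]]) (rule *)
  moreover have "\<zero> \<le> s \<sqinter> s'"
    using orth_ge[OF assms(5)[of 0]] limit_of_upper[OF assms(3), of 0] limit_of_upper[OF assms(4), of 0]
    by (meson le_infI order_trans)
  ultimately show ?thesis by simp
qed

text \<open>The countable version of \<open>persp_sup\<close>: the partial joins of small axes are axes for the
  partial joins, and by continuity their supremum is an axis for the suprema.\<close>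

lemma persp_limit:
  assumes "\<And>n. x n \<sim> y n"
    and X: "X 0 = \<zero>" "\<And>n. X n \<perp> x n" "\<And>n. X (Suc n) = X n \<squnion> x n" "limit_of X s"
    and Y: "Y 0 = \<zero>" "\<And>n. Y n \<perp> y n" "\<And>n. Y (Suc n) = Y n \<squnion> y n" "limit_of Y r"
    and sr: "s \<perp> r"
  shows "s \<sim> r"
proof -
  have "\<exists>t. perspective_by t (x n) (y n) \<and> t \<le> x n \<squnion> y n" for n
    using persp_small_axis[OF assms(1)[of n]] by blast
  then obtain t where t: "\<And>n. perspective_by (t n) (x n) (y n)" "\<And>n. t n \<le> x n \<squnion> y n"
    by metis
  define T where "T = rec_nat \<zero> (\<lambda>n T. T \<squnion> t n)"
  have T0: "T 0 = \<zero>" and TS: "T (Suc n) = T n \<squnion> t n" for n by (simp_all add: T_def)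
  have mX: "mono X" and mY: "mono Y" and mT: "mono T"
    by (simp_all add: mono_iff_le_Suc X Y TS)
  have le: "X n \<le> s" "Y n \<le> r" for n using limit_of_upper X(4) Y(4) by blast+
  have X0: "\<zero> \<le> X n" and Y0: "\<zero> \<le> Y n" for n using orth_ge X(2) Y(2) by blast+
  have *: "perspective_by (T n) (X n) (Y n) \<and> T n \<le> X n \<squnion> Y n" for n
  proof (induction n)
    case 0
    then show ?case by (simp add: T0 X(1) Y(1) perspective_by_def)
  next
    case (Suc n)
    have "(X n \<squnion> x n) \<perp> (Y n \<squnion> y n)"
      using orth_mono[OF sr le(1) le(2) X0 Y0, of "Suc n" "Suc n"] by (simp add: X Y)
    then have "perspective_by (T n \<squnion> t n) (X n \<squnion> x n) (Y n \<squnion> y n)"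
      using perspective_by_sup Suc.IH t X(2) Y(2) by blast
    moreover have "T n \<squnion> t n \<le> X n \<squnion> x n \<squnion> (Y n \<squnion> y n)"
    proof -
      have "T n \<squnion> t n \<le> (X n \<squnion> Y n) \<squnion> (x n \<squnion> y n)" using Suc.IH t(2) by (meson sup.mono)
      then show ?thesis by (simp add: sup.assoc sup.left_commute)
    qed
    ultimately show ?case by (simp add: TS X(3) Y(3))
  qed
  have "T n \<le> s \<squnion> r" for n using * le by (meson order_trans sup.mono)
  then obtain q where q: "limit_of T q" using limit_exists[OF mT] by blast
  have sq: "s \<perp> q" "r \<perp> q"
    using orth_limits[OF mX mT X(4) q] orth_limits[OF mY mT Y(4) q] * by (auto simp: perspective_by_def)
  have Tq: "T n \<le> q" for n using limit_of_upper[OF q] .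
  have eq: "X n \<squnion> T n = Y n \<squnion> T n" for n using * by (simp add: perspective_by_def)
  have "X n \<le> r \<squnion> q" for n
    using eq[of n] le(2)[of n] Tq[of n] by (metis order_trans sup.mono sup_ge1)
  then have 1: "s \<le> r \<squnion> q" by (rule limit_of_least[OF X(4)])
  have "Y n \<le> s \<squnion> q" for n
    using eq[of n] le(1)[of n] Tq[of n] by (metis order_trans sup.mono sup_ge1)
  then have "r \<le> s \<squnion> q" by (rule limit_of_least[OF Y(4)])
  with 1 have "s \<squnion> q = r \<squnion> q" by (intro antisym le_supI) auto
  with sq show ?thesis unfolding persp_def perspective_by_def by blast
qed

text \<open>Isomorphisms of intervals preserve limits, and so does the meet with \<open>m\<close>, by continuity;
  hence iterating \<open>v \<mapsto> c \<squnion> (f v \<sqinter> m)\<close> from \<open>c\<close> leads to a fixed point in countably many steps.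
  The stages are part of the conclusion because the limit will be decomposed along them.\<close>

lemma kleene_fixed_point:
  assumes f: "interval_iso f g u p" and "\<zero> \<le> c" "c \<le> u" "\<zero> \<le> m" "m \<le> u"
  obtains K s where "K 0 = c" "\<And>n. K (Suc n) = c \<squnion> (f (K n) \<sqinter> m)"
    "mono K" "\<And>n. \<zero> \<le> K n" "\<And>n. K n \<le> u" "limit_of K s" "s = c \<squnion> (f s \<sqinter> m)" "\<zero> \<le> s" "s \<le> u"
proof -
  define K where "K = rec_nat c (\<lambda>n v. c \<squnion> (f v \<sqinter> m))"
  have K0: "K 0 = c" and KS: "K (Suc n) = c \<squnion> (f (K n) \<sqinter> m)" for n by (simp_all add: K_def)
  have Kge: "\<zero> \<le> K n" for n
    using assms(2) by (cases n) (auto simp: K0 KS le_supI1)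
  have Kle: "K n \<le> u" for n
    using assms(3,5) by (cases n) (auto simp: K0 KS le_infI2)
  have mK: "mono K"
  proof (rule incseq_SucI)
    fix n show "K n \<le> K (Suc n)"
    proof (induction n)
      case 0 then show ?case by (simp add: K0 KS)
    next
      case (Suc n)
      have "f (K n) \<le> f (K (Suc n))" using iso_mono[OF f Kge Suc.IH Kle] .
      then have "f (K n) \<sqinter> m \<le> f (K (Suc n)) \<sqinter> m" by (rule inf_mono) simp
      then show ?case by (simp only: KS[of n] KS[of "Suc n"]) (simp add: le_supI2)
    qed
  qed
  obtain s where s: "limit_of K s" using limit_exists[OF mK Kle] by blast
  have su: "s \<le> u" using limit_of_least[OF s Kle] .
  have s0: "\<zero> \<le> s" using Kge limit_of_upper[OF s] order_trans by blast
  have lf: "limit_of (\<lambda>n. f (K n)) (f s)" using iso_limit[OF f s su Kge] .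
  have mf: "mono (\<lambda>n. f (K n))"
    using iso_mono[OF f Kge _ Kle] mK by (simp add: mono_def)
  have "s \<le> c \<squnion> (f s \<sqinter> m)"
  proof (rule limit_of_least[OF s])
    fix n
    have "K n \<le> K (Suc n)" using mK by (simp add: monoD)
    also have "\<dots> \<le> c \<squnion> (f s \<sqinter> m)"
      unfolding KS using limit_of_upper[OF lf] by (meson inf_mono order_refl sup.mono)
    finally show "K n \<le> c \<squnion> (f s \<sqinter> m)" .
  qed
  moreover have "m \<sqinter> f s \<le> s"
  proof (rule limit_of_least[OF inf_limit[OF mf lf]])
    fix n
    have "m \<sqinter> f (K n) \<le> K (Suc n)" by (simp add: KS inf_commute)
    then show "m \<sqinter> f (K n) \<le> s" using limit_of_upper[OF s] order_trans by blast
  qed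
  moreover have "c \<le> s" using limit_of_upper[OF s, of 0] by (simp add: K0)
  ultimately have "s = c \<squnion> (f s \<sqinter> m)" by (intro antisym) (auto simp: inf_commute)
  then show thesis using that K0 KS mK Kge Kle s s0 su by blast
qed

end

context rc_modular begin

lemma persp_part:
  assumes "x \<sim> y" "\<zero> \<le> v" "v \<le> x"
  obtains w where "w \<le> y" "v \<sim> w"
proof -
  obtain f g where f: "interval_iso f g x y" "\<And>v. \<zero> \<le> v \<Longrightarrow> v \<le> x \<Longrightarrow> v \<sim> f v"
    using persp_iso[OF assms(1)] by blast
  show thesis using that[of "f v"] f(2)[OF assms(2,3)] iso_le[OF f(1) assms(2,3)] by blast
qed

text \<open>An independent triple again, with the disjointness stated for the outer pair first.\<close>

lemma persp_trans_outside:
  assumes "x \<sim> w" "w \<sim> y" "x \<perp> y" "(x \<squnion> y) \<perp> w"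
  shows "x \<sim> y"
proof (rule persp_trans_independent[OF assms(1,2)])
  have "y \<perp> (x \<squnion> w)" using orth_assoc[of y x w] assms(3,4) by (simp add: inf_commute sup_commute)
  then show "(x \<squnion> w) \<perp> y" by (rule orth_sym)
  show "x \<perp> w" using orth_mono[OF assms(4), of x w] persp_ge[OF assms(1)] by simp
qed

text \<open>Although \<open>u\<close> and \<open>p\<close> may overlap, every part of \<open>u\<close> that is moved off itself forms an
  independent triple with its image below \<open>t\<close>.\<close>

lemma persp_iso_outside:
  assumes "u \<sim> t" "t \<sim> p" "(u \<squnion> p) \<perp> t"
  obtains f g where "interval_iso f g u p" "\<And>v. \<zero> \<le> v \<Longrightarrow> v \<le> u \<Longrightarrow> v \<perp> f v \<Longrightarrow> v \<sim> f v"
proof -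
  obtain f g where f: "interval_iso f g u t" "\<And>v. \<zero> \<le> v \<Longrightarrow> v \<le> u \<Longrightarrow> v \<sim> f v"
    using persp_iso[OF assms(1)] by blast
  obtain f' g' where f': "interval_iso f' g' t p" "\<And>v. \<zero> \<le> v \<Longrightarrow> v \<le> t \<Longrightarrow> v \<sim> f' v"
    using persp_iso[OF assms(2)] by blast
  have "v \<sim> f' (f v)" if v: "\<zero> \<le> v" "v \<le> u" "v \<perp> f' (f v)" for v
  proof (rule persp_trans_outside)
    have fv: "\<zero> \<le> f v" "f v \<le> t" using iso_ge[OF f(1) v(1,2)] iso_le[OF f(1) v(1,2)] .
    show "v \<sim> f v" "f v \<sim> f' (f v)" using f(2) f'(2) v fv by blast+
    show "v \<perp> f' (f v)" by fact
    show "v \<squnion> f' (f v) \<perp> f v"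
      by (rule orth_mono[OF assms(3)])
        (use v fv iso_le[OF f'(1) fv] in \<open>auto intro: le_supI1 le_supI2\<close>)
  qed
  then show thesis using that iso_comp[OF f(1) f'(1)] by blast
qed

end

context continuous_modular begin

section \<open>Comparison of elements connected by a shift\<close>

text \<open>The meet of \<open>u\<close> and \<open>p\<close> splits off a complement \<open>c\<close> in \<open>u\<close>. Let \<open>s\<close> be the least element
  above \<open>c\<close> that contains the part of its own image lying in \<open>u\<close>. The stages
  of its construction differ by elements \<open>k n\<close> that are disjoint from their images: the image of
  \<open>k n\<close> is disjoint from the image of the previous stage, and that image contains whatever part of
  \<open>p\<close> lies below the current stage. Hence \<open>k n\<close> is perspective to a part of \<open>q\<close>, and so is \<open>s\<close> in the limit. The
  remaining part \<open>M\<close> of \<open>u\<close> lies below \<open>p\<close>, disjoint from \<open>f s\<close>, and is moved by \<open>h\<close> alone.\<close>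

lemma partial_shift:
  assumes f: "interval_iso f g u p" and f_persp: "\<And>v. \<zero> \<le> v \<Longrightarrow> v \<le> u \<Longrightarrow> v \<perp> f v \<Longrightarrow> v \<sim> f v"
    and pq: "p \<sim> q" and up_q: "(u \<squnion> p) \<perp> q"
  obtains q1 where "q1 \<le> q" "u \<sim> q1"
proof -
  obtain h h' where h: "interval_iso h h' p q" "\<And>v. \<zero> \<le> v \<Longrightarrow> v \<le> p \<Longrightarrow> v \<sim> h v"
    using persp_iso[OF pq] by blast
  note hf = iso_comp[OF f h(1)]
  let ?m = "u \<sqinter> p"
  have u0: "\<zero> \<le> u" "\<zero> \<le> p" "\<zero> \<le> q" using iso_ends[OF f] iso_ends[OF h(1)] by auto
  obtain c where c: "?m \<perp> c" "?m \<squnion> c = u" "\<zero> \<le> c" "c \<le> u"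
    using complement[of ?m u] u0 by auto
  have cp: "c \<perp> p"
    using inf_eq_within[OF c(4), of p ?m] c(1) by (simp add: inf_commute)
  (* Of an element c \<squnion> w with w below both u and p, exactly w lies below p. *)
  have restrict: "(c \<squnion> w) \<sqinter> p = w" if "\<zero> \<le> w" "w \<le> ?m" for w
  proof -
    have "(w \<squnion> c) \<sqinter> p = w \<squnion> (c \<sqinter> p)" using that by (simp add: modular_law)
    then show ?thesis using cp that by (simp add: sup_commute sup_absorb1)
  qed
  obtain K s where K: "K 0 = c" "\<And>n. K (Suc n) = c \<squnion> (f (K n) \<sqinter> ?m)" "mono K"
      "\<And>n. \<zero> \<le> K n" "\<And>n. K n \<le> u"
    and s: "limit_of K s" "s = c \<squnion> (f s \<sqinter> ?m)" "\<zero> \<le> s" "s \<le> u"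
    using kleene_fixed_point[OF f c(3,4), of ?m] u0 by auto
  (* The stages are shifted by one so that the partial joins of the k n start from zero. *)
  define X where "X n = (case n of 0 \<Rightarrow> \<zero> | Suc j \<Rightarrow> K j)" for n
  have X0: "X 0 = \<zero>" and XS: "X (Suc n) = K n" for n by (simp_all add: X_def)
  have Xge: "\<zero> \<le> X n" and Xle: "X n \<le> u" for n
    using K(4,5) u0 by (simp_all add: X_def split: nat.split)
  have X_le_Suc: "X n \<le> X (Suc n)" for n
  proof (cases n)
    case 0 then show ?thesis using K(4) by (simp add: X0 XS)
  next
    case (Suc j)
    then show ?thesis using K(3) by (simp add: XS monoD)
  qed
  have lX: "limit_of X s"
    unfolding limit_of_def
  proof (intro allI iffI)
    fix w n assume "s \<le> w"
    then have "X (Suc n) \<le> w" using limit_of_upper[OF s(1)] by (auto simp: XS intro: order_trans)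
    then show "X n \<le> w" using X_le_Suc order_trans by blast
  next
    fix w assume "\<forall>n. X n \<le> w"
    then have "K n \<le> w" for n using XS by metis
    then show "s \<le> w" by (rule limit_of_least[OF s(1)])
  qed
  have "\<exists>k. X n \<perp> k \<and> X n \<squnion> k = X (Suc n)" for n
    using relative_complement[OF Xge X_le_Suc] .
  then obtain k where k: "\<And>n. X n \<perp> k n" "\<And>n. X n \<squnion> k n = X (Suc n)" by metis
  have kge: "\<zero> \<le> k n" for n using orth_ge[OF k(1)] by blast
  have kle: "k n \<le> X (Suc n)" for n unfolding k(2)[symmetric] by simp
  have kle_u: "k n \<le> u" for n using kle Xle order_trans by blast
  have Xp: "X (Suc n) \<sqinter> p \<le> f (X n)" for n
  proof (cases n)
    case 0
    then show ?thesis using cp iso_zero[OF f] by (simp add: XS X0 K(1))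
  next
    case (Suc j)
    have "\<zero> \<le> f (K j)" using iso_ge[OF f K(4,5)] .
    then have "K (Suc j) \<sqinter> p = f (K j) \<sqinter> ?m"
      using restrict[OF _ inf_le2, of "f (K j)"] u0 by (simp add: K(2))
    then show ?thesis by (simp add: Suc XS)
  qed
  have hf_orth: "v \<perp> h (f w)" if "\<zero> \<le> v" "v \<le> u \<squnion> p" "\<zero> \<le> w" "w \<le> u" for v w
    using orth_mono[OF up_q that(2) iso_le[OF hf that(3,4)] that(1) iso_ge[OF hf that(3,4)]] .
  have kpersp: "k n \<sim> h (f (k n))" for n
  proof -
    have fk: "\<zero> \<le> f (k n)" "f (k n) \<le> p"
      using iso_ge[OF f kge kle_u] iso_le[OF f kge kle_u] .
    have "k n \<sqinter> f (k n) \<le> X (Suc n) \<sqinter> p" using kle fk by (meson inf_mono)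
    also have "\<dots> \<le> f (X n)" by (rule Xp)
    finally have "k n \<sqinter> f (k n) \<le> f (X n) \<sqinter> f (k n)" by simp
    also have "\<dots> = \<zero>" using iso_orth[OF f k(1) Xle kle_u] .
    finally have "k n \<perp> f (k n)" using kge[of n] fk by (intro antisym) auto
    then have 1: "k n \<sim> f (k n)" using f_persp kge kle_u by blast
    show ?thesis
      by (rule persp_trans_orth[OF 1 h(2)[OF fk]], rule hf_orth)
        (use kge[of n] kle_u[of n] fk in \<open>auto intro: le_supI1 le_supI2\<close>)
  qed
  have 1: "s \<sim> h (f s)"
  proof (rule persp_limit[of k "\<lambda>n. h (f (k n))" X s "\<lambda>n. h (f (X n))"])
    show "h (f (X 0)) = \<zero>" using iso_zero[OF hf] by (simp add: X0)
    show "h (f (X n)) \<perp> h (f (k n))" for n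
      by (rule iso_orth[OF hf k(1) Xle kle_u])
    show "h (f (X (Suc n))) = h (f (X n)) \<squnion> h (f (k n))" for n
      by (simp only: k(2)[symmetric] iso_sup[OF hf Xge Xle kge kle_u])
    show "limit_of (\<lambda>n. h (f (X n))) (h (f s))" using iso_limit[OF hf lX s(4) Xge] .
    show "s \<perp> h (f s)" by (rule hf_orth) (use s in \<open>auto intro: le_supI1\<close>)
  qed (simp_all add: X0 k kpersp lX)
  have fs: "\<zero> \<le> f s" "f s \<le> p" using iso_ge[OF f s(3,4)] iso_le[OF f s(3,4)] .
  have "\<zero> \<le> f s \<sqinter> ?m" using fs u0 by simp
  then obtain M where M: "(f s \<sqinter> ?m) \<perp> M" "(f s \<sqinter> ?m) \<squnion> M = ?m" "\<zero> \<le> M" "M \<le> ?m"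
    using complement[OF _ inf_le2] by blast
  have usM: "u = s \<squnion> M"
    using c(2) M(2) s(2) by (metis sup.assoc sup.commute)
  have "s \<sqinter> p = f s \<sqinter> ?m" using restrict[OF _ inf_le2, of "f s"] fs u0 s(2) by simp
  then have sM: "s \<perp> M"
    using inf_eq_within[of M p s] M(1,4) by (simp add: inf_commute)
  have fsM: "f s \<perp> M"
    using inf_eq_within[of M ?m "f s"] M(1,4) by (simp add: inf_commute)
  have Mp: "M \<le> p" using M(4) by simp
  have hs: "h (f s) \<le> q" "h M \<le> q" using iso_le[OF h(1)] fs M(3) Mp by blast+
  have "s \<squnion> M \<sim> h (f s) \<squnion> h M"
  proof (rule persp_sup[OF 1 h(2)[OF M(3) Mp] sM])
    show "h (f s) \<perp> h M" by (rule iso_orth[OF h(1) fsM fs(2) Mp])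
    show "(s \<squnion> M) \<perp> (h (f s) \<squnion> h M)"
      by (rule orth_mono[OF up_q])
        (use usM u0 hs iso_ge[OF h(1) fs] in \<open>auto intro: le_supI1\<close>)
  qed
  then show thesis using that[of "h (f s) \<squnion> h M"] usM hs by simp
qed

text \<open>The Cantor-Bernstein argument. With \<open>f\<close> the composite of the two embeddings and \<open>c\<close> the
  part of \<open>x\<close> outside the image of \<open>y\<close>, the least \<open>s\<close> with \<open>s = c \<squnion> f s\<close> is the part of \<open>x\<close> to be
  moved by \<open>a\<close>; a complement \<open>M\<close> of \<open>f s\<close> in \<open>x1\<close> is moved by the inverse of \<open>b\<close>.\<close>

lemma persp_antisym:
  assumes "x \<perp> y" and "x \<sim> y1" "y1 \<le> y" and "y \<sim> x1" "x1 \<le> x"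
  shows "x \<sim> y"
proof -
  obtain a a' where a: "interval_iso a a' x y1" "\<And>v. \<zero> \<le> v \<Longrightarrow> v \<le> x \<Longrightarrow> v \<sim> a v"
    using persp_iso[OF assms(2)] by blast
  obtain b b' where b: "interval_iso b b' y x1" "\<And>v. \<zero> \<le> v \<Longrightarrow> v \<le> y \<Longrightarrow> v \<sim> b v"
    using persp_iso[OF assms(4)] by blast
  note b' = iso_sym[OF b(1)]
  note ge = iso_ends[OF a(1)] iso_ends[OF b(1)]
  define f where "f v = b (a v)" for v
  obtain f' where f: "interval_iso f f' x (b y1)"
    using iso_comp[OF a(1) iso_restrict[OF b(1) ge(2) assms(3)]] unfolding f_def by blast
  obtain c where c: "x1 \<perp> c" "x1 \<squnion> c = x" "\<zero> \<le> c" "c \<le> x"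
    using complement[OF ge(4) assms(5)] by blast
  obtain s where s: "s = c \<squnion> (f s \<sqinter> x)" "\<zero> \<le> s" "s \<le> x"
    using kleene_fixed_point[OF f c(3,4) ge(1) order_refl] by metis
  have as: "\<zero> \<le> a s" "a s \<le> y" using iso_ge[OF a(1) s(2,3)] iso_le[OF a(1) s(2,3)] assms(3) by auto
  have fs: "\<zero> \<le> f s" "f s \<le> x1" unfolding f_def using iso_ge[OF b(1) as] iso_le[OF b(1) as] .
  have s_eq: "s = c \<squnion> f s" using s(1) fs(2) assms(5) by (metis inf_absorb1 order_trans)
  obtain M where M: "f s \<perp> M" "f s \<squnion> M = x1" "\<zero> \<le> M" "M \<le> x1"
    using complement[OF fs] by blast
  have x_eq: "x = s \<squnion> M"
    using c(2) M(2) s_eq by (metis sup.assoc sup.commute)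
  have sM: "s \<perp> M"
    using orth_assoc[of M "f s" c] M(1,2) c(1) s_eq by (simp add: inf_commute sup_commute)
  have b's: "b' (f s) = a s" unfolding f_def using iso_inverse[OF b(1) as] .
  have M': "\<zero> \<le> b' M" "b' M \<le> y" using iso_ge[OF b' M(3,4)] iso_le[OF b' M(3,4)] .
  have "M \<sim> b' M"
    using persp_sym[OF b(2)[OF M']] iso_inverse[OF b' M(3,4)] by simp
  moreover have "a s \<perp> b' M" using iso_orth[OF b' M(1) fs(2) M(4)] by (simp add: b's)
  moreover have y_eq: "a s \<squnion> b' M = y"
    using iso_sup[OF b' fs M(3,4)] iso_top[OF b'] M(2) b's by simp
  ultimately show ?thesis
    using persp_sup[OF a(2)[OF s(2,3)] _ sM, of "b' M"] assms(1) x_eq by simp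
qed

text \<open>Applying \<open>partial_shift\<close> to the given chain yields \<open>u \<sim> q1 \<le> q\<close>, and applying it to
  \<open>p \<sim> t \<sim> u \<sim> q1\<close> yields \<open>p \<sim> q2 \<le> q1\<close>. The first perspectivity carries \<open>q2\<close> back to some
  \<open>u2 \<le> u\<close>, so that \<open>q \<sim> p \<sim> q2 \<sim> u2\<close> is a chain of the same shape and \<open>q\<close> is perspective to a
  part of \<open>u\<close>.\<close>

lemma persp_shift:
  assumes ut: "u \<sim> t" and tp: "t \<sim> p" and pq: "p \<sim> q" and "(u \<squnion> p) \<perp> t" "(u \<squnion> p) \<perp> q"
  shows "u \<sim> q"
proof -
  have embed: "\<exists>q1\<le>q. u \<sim> q1"
    if "u \<sim> t" "t \<sim> p" "p \<sim> q" "(u \<squnion> p) \<perp> t" "(u \<squnion> p) \<perp> q" for u t p q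
    using persp_iso_outside[OF that(1,2,4)] partial_shift[OF _ _ that(3,5)] by metis
  obtain q1 where q1: "q1 \<le> q" "u \<sim> q1" using embed[OF assms] by blast
  note ge = persp_ge[OF ut] persp_ge[OF pq] persp_ge[OF q1(2)]
  have "(p \<squnion> u) \<perp> q1"
    by (rule orth_mono[OF assms(5)]) (use q1 ge in \<open>auto intro: le_supI1\<close>)
  then obtain q2 where q2: "q2 \<le> q1" "p \<sim> q2"
    using embed[OF persp_sym[OF tp] persp_sym[OF ut] q1(2)] assms(4) by (auto simp: sup_commute)
  obtain u2 where u2: "u2 \<le> u" "q2 \<sim> u2"
    using persp_part[OF persp_sym[OF q1(2)] persp_ge(2)[OF q2(2)] q2(1)] .
  have le: "q2 \<le> q" using q1 q2 by simp
  have "(q \<squnion> q2) \<perp> p" "(q \<squnion> q2) \<perp> u2"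
    by (rule orth_mono[OF orth_sym[OF assms(5)]];
        use le u2 ge persp_ge[OF u2(2)] in \<open>auto intro: le_supI1 le_supI2\<close>)+
  then obtain u1 where u1: "u1 \<le> u2" "q \<sim> u1"
    using embed[OF persp_sym[OF pq] q2(2) u2(2)] by blast
  have uq: "u \<perp> q" by (rule orth_mono[OF assms(5)]) (use ge in auto)
  have "u1 \<le> u" using u1 u2 by simp
  from persp_antisym[OF uq q1(2,1) u1(2) this] show ?thesis .
qed

end

context rc_modular begin

section \<open>Refining relations\<close>

text \<open>Decompositions on the right can be transported to the left. This is shared by chains of
  perspectivities, by chains through elements below a bound and by projectivity by decomposition.\<close>

definition refining :: "('a \<Rightarrow> 'a \<Rightarrow> bool) \<Rightarrow> bool" where
  "refining R \<longleftrightarrow> (\<forall>x y1 y2. R x (y1 \<squnion> y2) \<and> y1 \<perp> y2 \<longrightarrow>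
     (\<exists>x1 x2. x1 \<perp> x2 \<and> x1 \<squnion> x2 = x \<and> R x1 y1 \<and> R x2 y2))"

lemma refiningD:
  assumes "refining R" "R x (y1 \<squnion> y2)" "y1 \<perp> y2"
  obtains x1 x2 where "x1 \<perp> x2" "x1 \<squnion> x2 = x" "R x1 y1" "R x2 y2"
  using assms unfolding refining_def by blast

lemma refining_persp: "refining persp"
  unfolding refining_def using persp_split persp_sym by metis

lemma refining_comp:
  assumes "refining R" "refining S"
  shows "refining (R OO S)"
  unfolding refining_def
proof (intro allI impI)
  fix x z1 z2 assume "(R OO S) x (z1 \<squnion> z2) \<and> z1 \<perp> z2"
  then obtain y where y: "R x y" "S y (z1 \<squnion> z2)" "z1 \<perp> z2" by blast
  obtain y1 y2 where 1: "y1 \<perp> y2" "y1 \<squnion> y2 = y" "S y1 z1" "S y2 z2"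
    using refiningD[OF assms(2) y(2,3)] .
  obtain x1 x2 where "x1 \<perp> x2" "x1 \<squnion> x2 = x" "R x1 y1" "R x2 y2"
    using refiningD[OF assms(1), of x y1 y2] y(1) 1(1,2) by blast
  then show "\<exists>x1 x2. x1 \<perp> x2 \<and> x1 \<squnion> x2 = x \<and> (R OO S) x1 z1 \<and> (R OO S) x2 z2"
    using 1(3,4) by blast
qed

lemma refining_bounded: "refining R \<Longrightarrow> refining (\<lambda>x y. R x y \<and> y \<le> b)"
  unfolding refining_def by (metis le_sup_iff)

lemma refining_chain: "refining (persp ^^ n)"
proof (induction n)
  case 0
  show ?case by (auto simp: refining_def)
next
  case (Suc n)
  then show ?case using refining_comp[OF Suc.IH refining_persp] by simp
qed

lemma chain_sym: "(persp ^^ n) x y \<Longrightarrow> (persp ^^ n) y x"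
proof (induction n arbitrary: y)
  case (Suc n)
  then obtain w where "(persp ^^ n) x w" "w \<sim> y" by auto
  then show ?case using Suc.IH persp_sym relpowp_Suc_I2 by metis
qed auto

text \<open>Cutting the connecting element \<open>b\<close> into \<open>b \<sqinter> z\<close> and a complement of it cuts \<open>a\<close> and \<open>c\<close>
  accordingly, and the perspectivities found for the parts add up because \<open>a\<close> and \<open>c\<close> are disjoint.\<close>

lemma persp_by_cutting:
  assumes R: "refining R" "R a b" and S: "refining S" "S c b"
    and "\<zero> \<le> b" "\<zero> \<le> z" "a \<perp> c"
    and below: "\<And>a' b' c'. a' \<le> a \<Longrightarrow> b' \<le> b \<Longrightarrow> c' \<le> c \<Longrightarrow> R a' b' \<Longrightarrow> S c' b' \<Longrightarrow> a' \<perp> c' \<Longrightarrow>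
      b' \<le> z \<Longrightarrow> a' \<sim> c'"
    and disjoint: "\<And>a' b' c'. a' \<le> a \<Longrightarrow> b' \<le> b \<Longrightarrow> c' \<le> c \<Longrightarrow> R a' b' \<Longrightarrow> S c' b' \<Longrightarrow> a' \<perp> c' \<Longrightarrow>
      b' \<perp> z \<Longrightarrow> a' \<sim> c'"
  shows "a \<sim> c"
proof -
  obtain b2 where b2: "(b \<sqinter> z) \<perp> b2" "(b \<sqinter> z) \<squnion> b2 = b" "b2 \<le> b"
    using complement[of "b \<sqinter> z" b] assms(5,6) by auto
  have b2z: "b2 \<perp> z"
    using inf_eq_within[OF b2(3), of z "b \<sqinter> z"] b2(1) by (simp add: inf_commute)
  obtain a1 a2 where a: "a1 \<perp> a2" "a1 \<squnion> a2 = a" "R a1 (b \<sqinter> z)" "R a2 b2"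
    using refiningD[OF R(1) _ b2(1)] R(2) b2(2) by metis
  obtain c1 c2 where c: "c1 \<perp> c2" "c1 \<squnion> c2 = c" "S c1 (b \<sqinter> z)" "S c2 b2"
    using refiningD[OF S(1) _ b2(1)] S(2) b2(2) by metis
  have le: "a1 \<le> a" "a2 \<le> a" "c1 \<le> c" "c2 \<le> c" using a(2) c(2) by auto
  note ge = orth_ge[OF a(1)] orth_ge[OF c(1)]
  have "a1 \<sim> c1"
    by (rule below[OF le(1) _ le(3) a(3) c(3)]) (use orth_mono[OF assms(7) le(1,3)] ge in auto)
  moreover have "a2 \<sim> c2"
    by (rule disjoint[OF le(2) b2(3) le(4) a(4) c(4)])
      (use orth_mono[OF assms(7) le(2,4)] ge b2z in auto)
  ultimately show ?thesis using persp_sup a(1,2) c(1,2) assms(7) by metis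
qed

end

context continuous_modular begin

section \<open>Disjoint projective elements are perspective\<close>

text \<open>Cutting \<open>b\<close> successively along \<open>a \<squnion> c\<close>, \<open>a\<close> and \<open>c\<close> leaves one case that is not an instance
  of the preceding transitivity lemmas: \<open>w \<le> a \<squnion> c\<close> disjoint from both \<open>a\<close> and \<open>c\<close>. Such a \<open>w\<close> is
  the graph of a perspectivity between its projections to \<open>a\<close> and to \<open>c\<close>. These projections need not be
  \<open>x\<close> and \<open>y\<close>, the elements below \<open>a\<close> and \<open>c\<close> that are perspective to \<open>w\<close>; shifting once on each
  side replaces them by \<open>x\<close> and \<open>y\<close>.\<close>

lemma persp_trans_disjoint:
  assumes "a \<sim> b" "b \<sim> c" "a \<perp> c"
  shows "a \<sim> c"
proof (rule persp_by_cutting[OF refining_persp assms(1) refining_persp persp_sym[OF assms(2)]])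
  note ge = persp_ge[OF assms(1)] persp_ge[OF assms(2)]
  show "\<zero> \<le> b" "\<zero> \<le> a \<squnion> c" "a \<perp> c" using ge assms(3) by (auto intro: le_supI1)
  show "a' \<sim> c'" if "a' \<le> a" "c' \<le> c" "a' \<sim> b'" "c' \<sim> b'" "a' \<perp> c'" "b' \<perp> (a \<squnion> c)" for a' b' c'
  proof (rule persp_trans_outside[OF that(3) persp_sym[OF that(4)] that(5)])
    show "a' \<squnion> c' \<perp> b'"
      by (rule orth_mono[OF orth_sym[OF that(6)]])
        (use that persp_ge[OF that(3)] in \<open>auto intro: le_supI1 le_supI2\<close>)
  qed
  show "a' \<sim> c'"
    if "a' \<le> a" "c' \<le> c" and 1: "a' \<sim> b'" "c' \<sim> b'" "a' \<perp> c'" "b' \<le> a \<squnion> c" for a' b' c'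
  proof (rule persp_by_cutting[OF refining_persp 1(1) refining_persp 1(2)])
    show "\<zero> \<le> b'" "\<zero> \<le> a" "a' \<perp> c'" using persp_ge[OF 1(1)] ge 1(3) by auto
    show "a'' \<sim> c''" if "a'' \<le> a'" "c'' \<le> c'" "a'' \<sim> b''" "c'' \<sim> b''" "b'' \<le> a" for a'' b'' c''
    proof (rule persp_trans_orth[OF that(3) persp_sym[OF that(4)]])
      show "a'' \<squnion> b'' \<perp> c''"
        by (rule orth_mono[OF assms(3)])
          (use that \<open>a' \<le> a\<close> \<open>c' \<le> c\<close> persp_ge[OF that(3)] persp_ge[OF that(4)] in \<open>auto intro: le_supI1\<close>)
    qed
    show "a'' \<sim> c''"
      if "a'' \<le> a'" "b'' \<le> b'" "c'' \<le> c'" and 2: "a'' \<sim> b''" "c'' \<sim> b''" "a'' \<perp> c''" "b'' \<perp> a"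
      for a'' b'' c''
    proof (rule persp_by_cutting[OF refining_persp 2(1) refining_persp 2(2)])
      show "\<zero> \<le> b''" "\<zero> \<le> c" "a'' \<perp> c''" using persp_ge[OF 2(1)] ge 2(3) by auto
      have a'': "a'' \<le> a" and b'': "b'' \<le> a \<squnion> c" and c'': "c'' \<le> c"
        using that(1-3) \<open>a' \<le> a\<close> \<open>c' \<le> c\<close> 1(4) by auto
      show "x \<sim> y" if "x \<le> a''" "y \<le> c''" "x \<sim> w" "y \<sim> w" "w \<le> c" for x w y
      proof -
        have "y \<squnion> w \<perp> x"
          by (rule orth_mono[OF orth_sym[OF assms(3)]])
            (use that a'' c'' persp_ge[OF that(3)] persp_ge[OF that(4)] in \<open>auto intro: le_supI1\<close>)
        then show ?thesis
          using persp_trans_orth[OF that(4) persp_sym[OF that(3)]] persp_sym by blast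
      qed
      show "x \<sim> y"
        if xy: "x \<le> a''" "w \<le> b''" "y \<le> c''" "x \<sim> w" "y \<sim> w" "x \<perp> y" "w \<perp> c" for x w y
      proof -
        have xw: "x \<le> a" "w \<le> a \<squnion> c" "y \<le> c" using xy(1-3) a'' b'' c'' by auto
        note ge' = persp_ge[OF xy(4)] persp_ge[OF xy(5)]
        have wa: "w \<perp> a"
          by (rule orth_mono[OF 2(4) xy(2) order_refl]) (use ge' ge in auto)
        (* The projections of w to a and to c. *)
        let ?p = "(w \<squnion> c) \<sqinter> a" and ?q = "(w \<squnion> a) \<sqinter> c"
        have ge'': "\<zero> \<le> ?p" "\<zero> \<le> ?q" using ge ge' by (auto intro: le_supI1)
        have pc: "?p \<perp> c" and qa: "?q \<perp> a"
          using orth_mono[OF assms(3), of ?p c] orth_mono[OF orth_sym[OF assms(3)], of ?q a] ge ge''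
          by simp_all
        have pw: "?p \<perp> w" and qw: "?q \<perp> w"
          using orth_mono[OF wa, of w ?p] orth_mono[OF xy(7), of w ?q] ge'' ge' by (simp_all add: inf_commute)
        have "c \<squnion> ?p = (c \<squnion> a) \<sqinter> (w \<squnion> c)" "a \<squnion> ?q = (a \<squnion> c) \<sqinter> (w \<squnion> a)"
          using modular_law[of c "w \<squnion> c" a] modular_law[of a "w \<squnion> a" c] by (simp_all add: inf_commute)
        then have cp: "?p \<squnion> c = w \<squnion> c" and aq: "?q \<squnion> a = w \<squnion> a"
          using xw(2) by (simp_all add: sup_commute inf_absorb2)
        have "w \<squnion> ?p = (w \<squnion> a) \<sqinter> (w \<squnion> c)" "w \<squnion> ?q = (w \<squnion> c) \<sqinter> (w \<squnion> a)"
          using modular_law[of w "w \<squnion> c" a] modular_law[of w "w \<squnion> a" c] by (simp_all add: inf_commute)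
        then have pq_eq: "?p \<squnion> w = ?q \<squnion> w" by (simp add: inf_commute sup_commute)
        have wp: "w \<sim> ?p" using pc cp xy(7) unfolding persp_def perspective_by_def by metis
        have wq: "w \<sim> ?q" using qa aq wa unfolding persp_def perspective_by_def by metis
        have pq: "?p \<sim> ?q" using pw qw pq_eq unfolding persp_def perspective_by_def by blast
        have "x \<sim> ?q"
        proof (rule persp_shift[OF xy(4) wp pq])
          show "x \<squnion> ?p \<perp> w"
            by (rule orth_mono[OF orth_sym[OF wa]]) (use xw ge' in \<open>auto intro: le_supI1\<close>)
          show "x \<squnion> ?p \<perp> ?q"
            by (rule orth_mono[OF assms(3)]) (use xw ge' ge'' in \<open>auto intro: le_supI1\<close>)
        qed
        then have "y \<sim> x"
        proof (rule persp_shift[OF xy(5) wq persp_sym])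
          show "y \<squnion> ?q \<perp> w"
            by (rule orth_mono[OF orth_sym[OF xy(7)]]) (use xw ge' in \<open>auto intro: le_supI1\<close>)
          show "y \<squnion> ?q \<perp> x"
            by (rule orth_mono[OF orth_sym[OF assms(3)]]) (use xw ge' ge'' in \<open>auto intro: le_supI1\<close>)
        qed
        then show ?thesis by (rule persp_sym)
      qed
    qed
  qed
qed

text \<open>For a chain \<open>x \<sim> y \<sim> w \<sim> \<dots> \<sim> z\<close>, cut \<open>y\<close> along \<open>z\<close> and then \<open>w\<close> along \<open>x\<close>. A piece of
  \<open>y\<close> disjoint from \<open>z\<close>, or of \<open>w\<close> disjoint from \<open>x\<close>, allows the chain to be shortened. Otherwise \<open>y \<le> z\<close>
  and \<open>w \<le> x\<close>, so \<open>w\<close> and the end of the chain are disjoint and \<open>x \<sim> y \<sim> w \<sim> z\<close> is the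
  configuration of \<open>persp_shift\<close>.\<close>

lemma persp_of_chain:
  assumes "(persp ^^ n) x z" "x \<perp> z"
  shows "x \<sim> z"
  using assms
proof (induction n arbitrary: x z rule: less_induct)
  case (less n)
  note xz = less.prems(2) and ge = orth_ge[OF less.prems(2)]
  show ?case
  proof (cases n)
    case 0
    then show ?thesis using less.prems(1) persp_refl ge by simp
  next
    case n1: (Suc n')
    show ?thesis
    proof (cases n')
      case 0
      then show ?thesis using less.prems(1) n1 by auto
    next
      case (Suc k)
      have IH1: "x \<sim> z" if "(persp ^^ Suc k) x z" "x \<perp> z" for x z
        by (rule less.IH[OF _ that]) (simp add: n1 Suc)
      have IH2: "x \<sim> z" if "(persp ^^ k) x z" "x \<perp> z" for x z
        by (rule less.IH[OF _ that]) (simp add: n1 Suc)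
      obtain y where y: "x \<sim> y" "(persp ^^ Suc k) y z"
        using less.prems(1) unfolding n1 Suc by (metis relpowp_Suc_D2)
      show ?thesis
      proof (rule persp_by_cutting[OF refining_persp y(1) refining_chain chain_sym[OF y(2)]])
        show "\<zero> \<le> y" "\<zero> \<le> z" "x \<perp> z" using persp_ge[OF y(1)] ge xz by auto
        show "x' \<sim> z'"
          if "z' \<le> z" "x' \<sim> y'" "(persp ^^ Suc k) z' y'" "x' \<perp> z'" "y' \<perp> z" for x' y' z'
        proof -
          have "z' \<perp> y'"
            by (rule orth_mono[OF orth_sym[OF that(5)] that(1) order_refl])
              (use orth_ge[OF that(4)] orth_ge[OF that(5)] in auto)
          then have "z' \<sim> y'" using IH1 that(3) by blast
          then show ?thesis using persp_trans_disjoint[OF that(2) persp_sym that(4)] by blast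
        qed
        show "x' \<sim> z'"
          if le: "x' \<le> x" "z' \<le> z"
            and 1: "x' \<sim> y'" "(persp ^^ Suc k) z' y'" "x' \<perp> z'" "y' \<le> z" for x' y' z'
        proof -
          obtain w where w: "(persp ^^ k) z' w" "w \<sim> y'" using 1(2) by auto
          (* The bound on y is built into the relation, so that it survives the second cut. *)
          let ?R = "(\<lambda>x y. x \<sim> y \<and> y \<le> z) OO persp"
          have R: "?R x' w" using 1(1,4) persp_sym[OF w(2)] by blast
          show ?thesis
          proof (rule persp_by_cutting[OF refining_comp[OF refining_bounded[OF refining_persp] refining_persp]
                R refining_chain w(1)])
            show "\<zero> \<le> w" "\<zero> \<le> x" "x' \<perp> z'" using persp_ge[OF w(2)] ge 1(3) by auto
            show "a \<sim> c"
              if abc: "a \<le> x'" "c \<le> z'" "?R a b" "(persp ^^ k) c b" "a \<perp> c" "b \<perp> x" for a b c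
            proof -
              obtain v where v: "a \<sim> v" "v \<sim> b" using abc(3) by blast
              have "a \<perp> b"
                by (rule orth_mono[OF orth_sym[OF abc(6)] _ order_refl])
                  (use abc(1) le(1) persp_ge[OF v(1)] persp_ge[OF v(2)] in auto)
              then have "a \<sim> b" using persp_trans_disjoint[OF v] by blast
              then have "(persp ^^ Suc k) c a" using abc(4) persp_sym by auto
              then have "c \<sim> a" using IH1 abc(5) by (simp add: inf_commute)
              then show ?thesis by (rule persp_sym)
            qed
            show "a \<sim> c"
              if abc: "a \<le> x'" "c \<le> z'" "?R a b" "(persp ^^ k) c b" "a \<perp> c" "b \<le> x" for a b c
            proof -
              obtain v where v: "a \<sim> v" "v \<sim> b" "v \<le> z" using abc(3) by blast
              note ge' = persp_ge[OF v(1)] persp_ge[OF v(2)] orth_ge[OF abc(5)]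
              have cz: "c \<le> z" and ax: "a \<le> x" using abc(1,2) le by auto
              have "c \<perp> b"
                by (rule orth_mono[OF orth_sym[OF xz] cz abc(6)]) (use ge' in auto)
              then have "c \<sim> b" using IH2 abc(4) by blast
              then show ?thesis
              proof (rule persp_shift[OF v(1,2) persp_sym])
                show "a \<squnion> b \<perp> v" "a \<squnion> b \<perp> c"
                  by (rule orth_mono[OF xz]; use ax abc(6) v(3) cz ge' in \<open>auto intro: le_supI1\<close>)+
              qed
            qed
          qed
        qed
      qed
    qed
  qed
qed

end

context rc_modular begin

section \<open>Projectivity by decomposition\<close>

text \<open>A rule for transitivity would spoil the induction that proves (E3), since an intermediate element
  need not be orthogonal to the outer ones. With the two rules below, orthogonality passes to the
  pieces, and transitivity follows from refinement.\<close>

inductive decomp_projective :: "'a \<Rightarrow> 'a \<Rightarrow> bool" (infix "\<approx>" 50) where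
  projective: "\<zero> \<le> x \<Longrightarrow> (persp ^^ n) x y \<Longrightarrow> x \<approx> y"
| sum: "x1 \<approx> y1 \<Longrightarrow> x2 \<approx> y2 \<Longrightarrow> x1 \<perp> x2 \<Longrightarrow> y1 \<perp> y2 \<Longrightarrow> x1 \<squnion> x2 \<approx> y1 \<squnion> y2"

lemma chain_ge: "(persp ^^ n) x y \<Longrightarrow> \<zero> \<le> x \<Longrightarrow> \<zero> \<le> y"
  by (cases n) (auto dest: persp_ge)

lemma decomp_persp: "x \<sim> y \<Longrightarrow> x \<approx> y"
  by (rule projective[of x "Suc 0"]) (auto dest: persp_ge)

lemma decomp_refl: "\<zero> \<le> x \<Longrightarrow> x \<approx> x"
  using projective[of x 0 x] by simp

lemma decomp_sym: "x \<approx> y \<Longrightarrow> y \<approx> x"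
proof (induction rule: decomp_projective.induct)
  case (projective x n y)
  show ?case
    by (rule decomp_projective.projective[OF chain_ge[OF projective(2,1)] chain_sym[OF projective(2)]])
next
  case (sum x1 y1 x2 y2)
  show ?case using decomp_projective.sum[OF sum.IH sum.hyps(4,3)] .
qed

lemma decomp_persp_trans: "x \<approx> y \<Longrightarrow> y \<sim> z \<Longrightarrow> x \<approx> z"
proof (induction arbitrary: z rule: decomp_projective.induct)
  case (projective x n y)
  then show ?case using decomp_projective.projective[of x "Suc n" z] by auto
next
  case (sum x1 y1 x2 y2)
  obtain z1 z2 where "z1 \<perp> z2" "z1 \<squnion> z2 = z" "y1 \<sim> z1" "y2 \<sim> z2"
    using persp_split[OF sum.prems sum.hyps(4)] .
  then show ?case using sum.IH sum.hyps(3) decomp_projective.sum by blast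
qed

text \<open>Without distributivity, two decompositions of an element have a common refinement only up
  to perspectivity: \<open>y2\<close> and \<open>c \<squnion> e\<close> are both complements of \<open>y1\<close>, and \<open>z2\<close> and \<open>d \<squnion> e\<close> are both
  complements of \<open>z1\<close>, where \<open>d\<close> and \<open>c\<close> complement \<open>m = y1 \<sqinter> z1\<close> in \<open>y1\<close> and \<open>z1\<close>, and \<open>e\<close>
  complements \<open>y1 \<squnion> z1\<close>.\<close>

lemma common_refinement:
  assumes "y1 \<perp> y2" "z1 \<perp> z2" "y1 \<squnion> y2 = z1 \<squnion> z2"
  obtains m d c e y2c y2e z2d z2e where
    "m \<perp> d" "m \<squnion> d = y1" "y2c \<perp> y2e" "y2c \<squnion> y2e = y2"
    "m \<perp> c" "m \<squnion> c = z1" "z2d \<perp> z2e" "z2d \<squnion> z2e = z2"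
    "y2c \<sim> c" "y2e \<sim> e" "d \<sim> z2d" "e \<sim> z2e"
proof -
  note ge = orth_ge[OF assms(1)] orth_ge[OF assms(2)]
  let ?m = "y1 \<sqinter> z1"
  obtain d where d: "?m \<perp> d" "?m \<squnion> d = y1" "\<zero> \<le> d" "d \<le> y1"
    using complement[of ?m y1] ge by auto
  obtain c where c: "?m \<perp> c" "?m \<squnion> c = z1" "\<zero> \<le> c" "c \<le> z1"
    using complement[of ?m z1] ge by auto
  have "y1 \<squnion> z1 \<le> y1 \<squnion> y2" using assms(3) by (metis le_supI sup_ge1)
  then obtain e where e: "(y1 \<squnion> z1) \<perp> e" "(y1 \<squnion> z1) \<squnion> e = y1 \<squnion> y2" "\<zero> \<le> e"
    using complement[of "y1 \<squnion> z1" "y1 \<squnion> y2"] ge by (auto simp: le_supI1)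
  have dz: "z1 \<perp> d" using inf_eq_within[OF d(4), of z1 ?m] d(1) by (simp add: inf_commute)
  have cy: "y1 \<perp> c" using inf_eq_within[OF c(4), of y1 ?m] c(1) by (simp add: inf_commute)
  have yc: "y1 \<squnion> c = y1 \<squnion> z1" and zd: "z1 \<squnion> d = y1 \<squnion> z1"
    using c(2) d(2) by (metis sup.assoc sup_inf_absorb, metis sup.assoc sup_inf_absorb inf_commute sup_commute)
  have "y1 \<perp> (c \<squnion> e)" using orth_assoc[OF cy] e(1) yc by simp
  moreover have "y1 \<squnion> (c \<squnion> e) = y1 \<squnion> y2" using yc e(2) by (simp add: sup.assoc[symmetric])
  ultimately have y2: "c \<squnion> e \<sim> y2" using common_complement_persp assms(1) by blast
  have "z1 \<perp> (d \<squnion> e)" using orth_assoc[OF dz] e(1) zd by simp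
  moreover have "z1 \<squnion> (d \<squnion> e) = z1 \<squnion> z2" using zd e(2) assms(3) by (simp add: sup.assoc[symmetric])
  ultimately have z2: "d \<squnion> e \<sim> z2" using common_complement_persp assms(2) by blast
  have "c \<perp> e" "d \<perp> e" by (rule orth_mono[OF e(1)]; use c d e(3) in \<open>simp add: le_supI1 le_supI2\<close>)+
  then obtain y2c y2e z2d z2e where
    "y2c \<perp> y2e" "y2c \<squnion> y2e = y2" "c \<sim> y2c" "e \<sim> y2e"
    "z2d \<perp> z2e" "z2d \<squnion> z2e = z2" "d \<sim> z2d" "e \<sim> z2e"
    using persp_split[OF y2] persp_split[OF z2] by metis
  then show thesis using that[of ?m d y2c y2e c z2d z2e e] c d persp_sym by blast
qed

lemma refining_decomp: "refining decomp_projective"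
proof -
  have "\<exists>x1 x2. x1 \<perp> x2 \<and> x1 \<squnion> x2 = x \<and> x1 \<approx> z1 \<and> x2 \<approx> z2"
    if "x \<approx> y" "y = z1 \<squnion> z2" "z1 \<perp> z2" for x y z1 z2
    using that
  proof (induction arbitrary: z1 z2 rule: decomp_projective.induct)
    case (projective x n y)
    obtain x1 x2 where x: "x1 \<perp> x2" "x1 \<squnion> x2 = x" "(persp ^^ n) x1 z1" "(persp ^^ n) x2 z2"
      using refiningD[OF refining_chain, of n x z1 z2] projective by blast
    then show ?case using decomp_projective.projective orth_ge[OF x(1)] by blast
  next
    case (sum x1 y1 x2 y2)
    obtain m d c e y2c y2e z2d z2e where
      y: "m \<perp> d" "m \<squnion> d = y1" "y2c \<perp> y2e" "y2c \<squnion> y2e = y2" and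
      z: "m \<perp> c" "m \<squnion> c = z1" "z2d \<perp> z2e" "z2d \<squnion> z2e = z2" and
      p: "y2c \<sim> c" "y2e \<sim> e" "d \<sim> z2d" "e \<sim> z2e"
      by (rule common_refinement[OF sum.hyps(4) sum.prems(2,1)])
    obtain xm xd where x1: "xm \<perp> xd" "xm \<squnion> xd = x1" "xm \<approx> m" "xd \<approx> d"
      using sum.IH(1) y by metis
    obtain xc xe where x2: "xc \<perp> xe" "xc \<squnion> xe = x2" "xc \<approx> y2c" "xe \<approx> y2e"
      using sum.IH(2) y by metis
    have le: "xm \<le> x1" "xd \<le> x1" "xc \<le> x2" "xe \<le> x2" using x1 x2 by auto
    note ge = orth_ge[OF x1(1)] orth_ge[OF x2(1)]
    have "xm \<perp> xc" "xd \<perp> xe" using orth_mono[OF sum.hyps(3)] le ge by blast+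
    then have "xm \<squnion> xc \<approx> z1" "xd \<squnion> xe \<approx> z2"
      using decomp_projective.sum x1(3,4) x2(3,4) z decomp_persp_trans p by metis+
    moreover have "(xm \<squnion> xc) \<perp> (xd \<squnion> xe)"
      using orth_sup_sup[OF sum.hyps(3) le(1,2,3,4) x1(1) x2(1)] .
    moreover have "(xm \<squnion> xc) \<squnion> (xd \<squnion> xe) = x1 \<squnion> x2"
      unfolding x1(2)[symmetric] x2(2)[symmetric] by (simp add: sup.assoc sup.left_commute)
    ultimately show ?case by blast
  qed
  then show ?thesis unfolding refining_def by blast
qed

lemma decomp_trans: "y \<approx> z \<Longrightarrow> x \<approx> y \<Longrightarrow> x \<approx> z"
proof (induction arbitrary: x rule: decomp_projective.induct)
  case (projective y n z)
  then show ?case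
  proof (induction n arbitrary: z)
    case (Suc n)
    then show ?case using decomp_persp_trans by auto
  qed simp
next
  case (sum y1 z1 y2 z2)
  obtain x1 x2 where "x1 \<perp> x2" "x1 \<squnion> x2 = x" "x1 \<approx> y1" "x2 \<approx> y2"
    using refiningD[OF refining_decomp sum.prems sum.hyps(3)] .
  then show ?case using sum.IH sum.hyps(4) decomp_projective.sum by blast
qed

end

lemma (in continuous_modular) persp_of_decomp: "x \<approx> y \<Longrightarrow> x \<perp> y \<Longrightarrow> x \<sim> y"
proof (induction rule: decomp_projective.induct)
  case (projective x n y)
  then show ?case using persp_of_chain by blast
next
  case (sum x1 y1 x2 y2)
  note ge = orth_ge[OF sum.hyps(3)] orth_ge[OF sum.hyps(4)]
  have "x1 \<perp> y1" "x2 \<perp> y2"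
    by (rule orth_mono[OF sum.prems]; use ge in simp)+
  then show ?case using sum.IH persp_sup sum.hyps(3,4) sum.prems by blast
qed

section \<open>The normal equivalence of an interval\<close>

lemma (in continuous_modular) interval_normal:
  assumes "\<zero> \<le> b"
  shows "normal_with_zero {\<zero>..b}"
proof -
  let ?K = "{\<zero>..b}"
  let ?E = "{(x, y). x \<in> ?K \<and> y \<in> ?K \<and> x \<approx> y}"
  have "equiv ?K ?E"
    by (rule equivI)
      (auto simp: refl_on_def sym_def trans_def intro: decomp_refl decomp_sym decomp_trans)
  moreover have "additive_rel ?K \<zero> ?E"
    unfolding additive_rel_def is_osum_def orthogonal_def using sum by blast
  moreover have "refining_rel ?K \<zero> ?E"
    unfolding refining_rel_def is_osum_def orthogonal_def
  proof (intro ballI impI)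
    fix y x0 x1 z
    assume "y \<in> ?K" and x: "x0 \<in> ?K" "x1 \<in> ?K" "z \<in> ?K" "(x0 \<perp> x1 \<and> x0 \<squnion> x1 = z) \<and> (y, z) \<in> ?E"
    then obtain y0 y1 where y: "y0 \<perp> y1" "y0 \<squnion> y1 = y" "y0 \<approx> x0" "y1 \<approx> x1"
      using refiningD[OF refining_decomp, of y x0 x1] by auto
    have "y0 \<in> ?K" "y1 \<in> ?K" using orth_ge[OF y(1)] y(2) \<open>y \<in> ?K\<close> by auto
    then show "\<exists>y0\<in>?K. \<exists>y1\<in>?K. (y0, x0) \<in> ?E \<and> (y1, x1) \<in> ?E \<and> y0 \<perp> y1 \<and> y0 \<squnion> y1 = y"
      using x y by blast
  qed
  moreover have "(x, y) \<in> ?E" if "x \<in> ?K" "y \<in> ?K" "perspective ?K x y" for x y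
    using that persp_of_common_axis decomp_persp unfolding perspective_def by auto
  moreover have "perspective ?K x y" if xy: "x \<in> ?K" "y \<in> ?K" "x \<perp> y" "(x, y) \<in> ?E" for x y
  proof -
    obtain t where t: "perspective_by t x y" "t \<le> x \<squnion> y"
      using persp_small_axis[OF persp_of_decomp] xy by auto
    moreover have "x \<squnion> y \<le> b" using xy by simp
    ultimately have "t \<in> ?K"
      using orth_ge(2) unfolding perspective_by_def by (metis atLeastAtMost_iff order_trans)
    with t(1) show ?thesis
      unfolding perspective_def perspective_by_def by (intro bexI[of _ t]) simp_all
  qed
  ultimately have "normal_equivalence ?K \<zero> ?E"
    unfolding normal_equivalence_def orthogonal_def by blast
  moreover have "is_zero ?K \<zero>" using assms by (simp add: is_zero_def)
  ultimately show ?thesis unfolding normal_with_zero_def by blast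
qed

text \<open>A supremum in an interval is a supremum in the whole lattice, since upper bounds can be
  truncated at the top of the interval.\<close>

lemma limit_of_isLub:
  fixes l c :: "'a::lattice"
  assumes "isLub {l..c} (range b) s" and b: "range b \<subseteq> {l..c}"
  shows "limit_of b s"
proof -
  have s: "b n \<le> s" for n
    using assms by (auto simp: isLub_def leastP_def isUb_def setle_def)
  have "s \<le> w" if w: "\<forall>n. b n \<le> w" for w
  proof -
    have "b n \<le> w \<sqinter> c" "l \<le> b n" for n using w subsetD[OF b, of "b n"] by auto
    then have "isUb {l..c} (range b) (w \<sqinter> c)"
      by (auto simp: isUb_def setle_def intro: order_trans)
    then have "s \<le> w \<sqinter> c" using assms(1) by (auto simp: isLub_def leastP_def setge_def)
    then show ?thesis by simp
  qed
  then show ?thesis unfolding limit_of_def using s order_trans by blast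
qed

theorem theorem12p18:
  assumes "modular_lattice (UNIV :: 'a::lattice set)"
    and "relatively_complemented (UNIV :: 'a set)"
    and "conditionally_aleph0_meet_continuous (UNIV :: 'a set)"
  shows "normal_lattice (UNIV :: 'a set)"
proof -
  have interval: "{a..b} \<in> closed_intervals (UNIV :: 'a set)" if "a \<le> b" for a b :: 'a
    using that unfolding closed_intervals_def by auto
  have modular: "x \<squnion> (y \<sqinter> z) = (x \<squnion> y) \<sqinter> z" if "x \<le> z" for x y z :: 'a
    using assms(1) that unfolding modular_lattice_def by blast
  have complement: "\<exists>y. x \<sqinter> y = a \<and> x \<squnion> y = b" if "a \<le> x" "x \<le> b" for a b x :: 'a
  proof -
    have "complemented_lattice {a..b}"
      using assms(2) interval that order_trans unfolding relatively_complemented_def by blast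
    then obtain z e where ze: "is_zero {a..b} z" "is_unit_element {a..b} e"
      "\<forall>x\<in>{a..b}. \<exists>y\<in>{a..b}. x \<sqinter> y = z \<and> x \<squnion> y = e"
      unfolding complemented_lattice_def by blast
    have "a \<le> b" using that by (rule order_trans)
    then have "z = a" "e = b"
      using ze(1,2) unfolding is_zero_def is_unit_element_def by (auto intro: antisym)
    then show ?thesis using ze(3) that by auto
  qed
  have continuous: "\<exists>s. isLub {l..c} (range b) s \<and> isLub {l..c} (range (\<lambda>n. a \<sqinter> b n)) (a \<sqinter> s)"
    if "mono b" "range b \<subseteq> {l..c}" "a \<in> {l..c}" for a l c :: 'a and b :: "nat \<Rightarrow> 'a"
  proof -
    have "l \<le> c" using that(3) by auto
    then show ?thesis
      using assms(3) interval that
      unfolding conditionally_aleph0_meet_continuous_def aleph0_meet_continuous_def by blast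
  qed
  have limits: "\<exists>s. limit_of b s"
    if "mono b" "\<And>n. b n \<le> c" for b :: "nat \<Rightarrow> 'a" and c
  proof -
    have b: "range b \<subseteq> {b 0..c}" using that by (auto simp: monoD)
    then have "b 0 \<in> {b 0..c}" by blast
    then show ?thesis using continuous[OF that(1) b] limit_of_isLub[OF _ b] by blast
  qed
  have inf_limits: "limit_of (\<lambda>n. a \<sqinter> b n) (a \<sqinter> s)"
    if mono: "mono b" and limit: "limit_of b s" for b :: "nat \<Rightarrow> 'a" and a s
  proof -
    have upper: "b n \<le> s" for n using limit_of_upper[OF limit] .
    (* The interval must contain all b n and the part of a below s, but a itself is arbitrary. *)
    let ?l = "a \<sqinter> b 0" and ?a = "a \<sqinter> s"
    have le: "?l \<le> b n" for n using mono by (simp add: le_infI2 monoD)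
    then have b: "range b \<subseteq> {?l..s}" using upper by auto
    have a: "?a \<in> {?l..s}" using upper by (simp add: le_infI2)
    obtain s' where s': "isLub {?l..s} (range b) s'"
        "isLub {?l..s} (range (\<lambda>n. ?a \<sqinter> b n)) (?a \<sqinter> s')"
      using continuous[OF mono b a] by blast
    have eq: "?a \<sqinter> b n = a \<sqinter> b n" for n
      using upper by (simp add: inf.assoc inf_absorb2)
    have "s' = s"
      using limit_of_isLub[OF s'(1) b] limit unfolding limit_of_def by (meson antisym order_refl)
    moreover have "range (\<lambda>n. ?a \<sqinter> b n) \<subseteq> {?l..s}"
      using mono upper unfolding eq by (auto simp: le_infI2 monoD)
    ultimately show ?thesis using limit_of_isLub[OF s'(2)] by (simp add: eq)
  qed
  show ?thesis
    unfolding normal_lattice_def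
  proof
    fix I :: "'a set" assume "I \<in> closed_intervals UNIV"
    then obtain a b where I: "I = {a..b}" "a \<le> b" unfolding closed_intervals_def by auto
    interpret continuous_modular a
      by unfold_locales (fact modular complement limits inf_limits)+
    show "normal_with_zero I" using interval_normal[OF I(2)] I(1) by simp
  qed
qed

end
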